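(* Let $[S,T]\subseteq\mathbb{R}$ be an interval and let $m,n\in\mathbb{N}$. Let $p\in[1,3)$, let $\omega$ be a control function on $[S,T]$, and let $X$ be an $n$-dimensional branched rough path on $[S,T]$ with regularity $p$ and control $\omega$. Let $f:\mathbb{R}^m\to R_n^2\mathbb{R}^m$ be a compactly supported admissible rough velocity field. Let $Y,\widetilde{Y}:[S,T]\to\mathbb{R}^m$ be two integral curves of $f$ driven by $X$ such that $Y(S)=\widetilde{Y}(S)$. Then there exists $\varepsilon\in(0,\infty)$ such that $Y=\widetilde{Y}$ on $[S,S+\varepsilon]$.
   Context: Smooth means $C^\infty$; manifolds are smooth and finite-dimensional; superscripts $i$ denote coordinates. For $I\subseteq\mathbb{R}$, $\Delta I:=\{(s,t)\in I^2: s\le t\}$. A control function on $[S,T]$ is a continuous function $\omega:\Delta[S,T]\to[0,\infty)$ with $\omega(s,s)=0$ for all $s$ and $\omega(s,t)\ge\omega(s,u)+\omega(u,t)$ for all $S\le s\le u\le t\le T$. $\mathcal{F}_n^2$ is the set of non-empty forests of rooted trees with at most two vertices, with vertices labeled by $\{1,\dots,n\}$. Its elements are: the one-vertex trees, written $\alpha$; the forests made of two one-vertex trees, written $\alpha\cdot\beta=\beta\cdot\alpha$ (unordered, $\alpha=\beta$ allowed); and the two-vertex trees, written $\alpha|\beta$ (top vertex $\alpha$, bottom vertex $\beta$). The symmetry factor is $\sigma(\alpha)=1$, $\sigma(\alpha|\beta)=1$, $\sigma(\alpha\cdot\beta)=1$ if $\alpha\ne\beta$, and $\sigma(\alpha\cdot\alpha)=2$.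 For $p\in[1,3)$, an $n$-dimensional branched rough path on $[S,T]$ with regularity $p$ and control $\omega$ is a tuple $X=(X^\tau)_{\tau\in\mathcal{F}_n^2}$ of functions $X^\tau:\Delta[S,T]\to\mathbb{R}$ such that for all $\alpha,\beta$ and all $S\le s\le u\le t\le T$: $X^\alpha(s,t)=X^\alpha(s,u)+X^\alpha(u,t)$; $X^{\alpha\cdot\beta}(s,t)=X^\alpha(s,t)X^\beta(s,t)$; $X^{\alpha|\beta}(s,t)=X^{\alpha|\beta}(s,u)+X^{\alpha|\beta}(u,t)+X^\alpha(s,u)X^\beta(u,t)$; and such that for some $C\in(0,\infty)$, $|X^\alpha(s,t)|\le C\omega(s,t)^{1/p}$, $|X^{\alpha\cdot\beta}(s,t)|\le C\omega(s,t)^{2/p}$, $|X^{\alpha|\beta}(s,t)|\le C\omega(s,t)^{2/p}$ for all $\alpha,\beta$ and $(s,t)\in\Delta[S,T]$. Rough velocity bundle. $F_{mn}^2$ is the real vector space of tuples $(f^i_\tau)$, $i\in\{1,\dots,m\}$, $\tau\in\mathcal{F}_n^2$. $G_m^2$ is the Lie group of invertible $2$-jets of smooth maps $\mathbb{R}^m\to\mathbb{R}^m$ with source and target $0$; a jet $a$ is written $(a^i_j,a^i_{jk})$ with $a^i_{jk}=a^i_{kj}$ (first and second partial derivatives at $0$). It acts on $F_{mn}^2$ from the left by $af=g$, $g^i_\alpha=\sum_j a^i_jf^j_\alpha$, $g^i_{\alpha\cdot\beta}=\sum_j a^i_jf^j_{\alpha\cdot\beta}+\sum_{j,k}a^i_{jk}f^j_\alpha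 f^k_\beta$, $g^i_{\alpha|\beta}=\sum_j a^i_jf^j_{\alpha|\beta}$. For an $m$-dimensional manifold $M$, let $P^2M$ be the second-order frame bundle ($2$-jets $j^2_0\psi$ at $0$ of local diffeomorphisms $\psi:\mathbb{R}^m\to M$), a principal $G_m^2$-bundle; $R_n^2M$ is the associated bundle with fiber $F_{mn}^2$, i.e. the set of classes $[(j_0^2\psi,f)]$ under $(j^2_0\psi,f)\sim(j^2_0(\psi\circ a),a^{-1}f)$, with projection $\pi[(j_0^2\psi,f)]=\psi(0)$. A chart $(U,x)$ on $M$ induces coordinates $(x^i,f^i_\tau)$ on $\pi^{-1}(U)$: the class $[(j_0^2\psi,f)]$ has base coordinates $x(\psi(0))$ and fiber coordinates $af$, where $a\in G_m^2$ consists of the first and second derivatives of $x\circ\psi$ at $0$. Under a change of charts from $(U,x)$ to $(V,y)$ the fiber coordinates at $p$ change by the action of the jet with $a^i_j=\frac{\partial y^i}{\partial x^j}(p)$, $a^i_{jk}=\frac{\partial^2y^i}{\partial x^j\partial x^k}(p)$. A rough velocity field on $M$ is a smooth section $f:M\to R_n^2M$; in a chart $(U,x)$ it is represented by smooth functions $f^i_\tau:U\to\mathbb{R}$. Its support is the closure of the set of points $p$ at which the fiber coordinates $(f^i_\tau(p))$ are not all zero (this is chart-independent). It is admissible if for every $p\in M$ there is a chart $(U,x)$ around $p$ in which $\sum_j\frac{\partial f^i_\beta}{\partial x^j}(p)f^j_\alpha(p)=f^i_{\alpha\cdot\beta}(p)+f^i_{\alpha|\beta}(p)$ for all $i,\alpha,\beta$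 (this condition does not depend on the chart). A function $Y:[S,T]\to M$ is an integral curve of $f$ driven by $X$ if it is continuous and if for every compact interval $I\subseteq[S,T]$ and every chart $(U,x)$ with $Y(I)\subseteq U$ there exists $C\in(0,\infty)$ such that $\left|Y^i(t)-Y^i(s)-\sum_{\tau\in\mathcal{F}_n^2}\frac{1}{\sigma(\tau)}f^i_\tau(Y(s))X^\tau(s,t)\right|\le C\omega(s,t)^{3/p}$ for every $i$ and $(s,t)\in\Delta I$, where $Y^i=x^i\circ Y$ and $(f^i_\tau)$ represents $f$ in the chart induced by $(U,x)$. *)

theory Defs
  imports "HOL-Analysis.Analysis" "HOL-Library.Uprod"
begin

section \<open>Smooth maps and charts of Euclidean space\<close>

definition partial :: "'m \<Rightarrow> (real^'m \<Rightarrow> real) \<Rightarrow> real^'m \<Rightarrow> real" where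
  "partial j \<phi> p = frechet_derivative \<phi> (at p) (axis j 1)"

text \<open>\<open>Ck_on k U \<phi>\<close> is meant for open \<open>U\<close>: \<open>\<phi>\<close> is of class \<open>C\<^sup>k\<close> on \<open>U\<close>.\<close>

primrec Ck_on :: "nat \<Rightarrow> (real^'m) set \<Rightarrow> (real^'m \<Rightarrow> real) \<Rightarrow> bool" where
  "Ck_on 0 U \<phi> \<longleftrightarrow> continuous_on U \<phi>"
| "Ck_on (Suc k) U \<phi> \<longleftrightarrow> (\<forall>p\<in>U. \<phi> differentiable (at p)) \<and> (\<forall>j. Ck_on k U (partial j \<phi>))"

definition smooth_on :: "(real^'m) set \<Rightarrow> (real^'m \<Rightarrow> real) \<Rightarrow> bool" where
  "smooth_on U \<phi> \<longleftrightarrow> (\<forall>k. Ck_on k U \<phi>)"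

definition smooth_map_on :: "(real^'m) set \<Rightarrow> (real^'m \<Rightarrow> real^'m) \<Rightarrow> bool" where
  "smooth_map_on U \<psi> \<longleftrightarrow> (\<forall>i. smooth_on U (\<lambda>z. \<psi> z $ i))"

text \<open>The charts in the maximal atlas of the manifold \<open>\<real>\<^sup>m\<close> are the diffeomorphisms from
  an open set onto an open set.\<close>

definition chart :: "(real^'m) set \<Rightarrow> (real^'m \<Rightarrow> real^'m) \<Rightarrow> bool" where
  "chart U x \<longleftrightarrow> open U \<and> open (x ` U) \<and> inj_on x U \<and>
     smooth_map_on U x \<and> smooth_map_on (x ` U) (the_inv_into U x)"

definition local_diffeo_at_0 :: "(real^'m \<Rightarrow> real^'m) \<Rightarrow> bool" where
  "local_diffeo_at_0 \<psi> \<longleftrightarrow> (\<exists>W. 0 \<in> W \<and> chart W \<psi>)"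

text \<open>The derivative \<open>\<partial>\<phi>/\<partial>x\<^sup>j\<close> at \<open>p\<close> in a chart \<open>(U,x)\<close>.\<close>

definition chart_partial ::
  "(real^'m) set \<Rightarrow> (real^'m \<Rightarrow> real^'m) \<Rightarrow> 'm \<Rightarrow> (real^'m \<Rightarrow> real) \<Rightarrow> real^'m \<Rightarrow> real" where
  "chart_partial U x j \<phi> p = partial j (\<phi> \<circ> the_inv_into U x) (x p)"


section \<open>Forests with at most two vertices\<close>

text \<open>The labels \<open>{1,\<dots>,n}\<close> are the elements of a finite type \<open>'n\<close>.  The constructors stand
  for \<open>\<alpha>\<close>, \<open>\<alpha>\<cdot>\<beta>\<close> (an unordered pair) and \<open>\<alpha>|\<beta>\<close>.\<close>

datatype 'n forest = Vertex 'n | Pair_Forest "'n uprod" | Ladder 'n 'n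

abbreviation dot_forest :: "'n \<Rightarrow> 'n \<Rightarrow> 'n forest" (infixl "\<cdot>\<^sub>F" 70) where
  "\<alpha> \<cdot>\<^sub>F \<beta> \<equiv> Pair_Forest (Upair \<alpha> \<beta>)"

text \<open>Finiteness is needed for sums over all forests to have their intended meaning.\<close>

instance forest :: (finite) finite
proof
  have "(UNIV :: 'a forest set) \<subseteq>
      range Vertex \<union> range Pair_Forest \<union> range (\<lambda>(\<alpha>, \<beta>). Ladder \<alpha> \<beta>)"
  proof
    fix \<tau> :: "'a forest"
    show "\<tau> \<in> range Vertex \<union> range Pair_Forest \<union> range (\<lambda>(\<alpha>, \<beta>). Ladder \<alpha> \<beta>)"
      by (cases \<tau>) auto
  qed
  then show "finite (UNIV :: 'a forest set)"
    by (rule finite_subset) simp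
qed

fun sym_factor :: "'n forest \<Rightarrow> real" where
  "sym_factor (Vertex \<alpha>) = 1"
| "sym_factor (Pair_Forest P) = (if \<exists>\<alpha>. P = Upair \<alpha> \<alpha> then 2 else 1)"
| "sym_factor (Ladder \<alpha> \<beta>) = 1"


section \<open>Branched rough paths\<close>

text \<open>Functions on \<open>\<Delta>[S,T]\<close> and on \<open>[S,T]\<close> are total functions whose values elsewhere are
  never used.\<close>

definition simplex2 :: "real set \<Rightarrow> (real \<times> real) set" where
  "simplex2 I = {(s, t). s \<in> I \<and> t \<in> I \<and> s \<le> t}"

definition control :: "real \<Rightarrow> real \<Rightarrow> (real \<Rightarrow> real \<Rightarrow> real) \<Rightarrow> bool" where
  "control S T \<omega> \<longleftrightarrow>
     continuous_on (simplex2 {S..T}) (\<lambda>(s, t). \<omega> s t) \<and>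
     (\<forall>(s, t)\<in>simplex2 {S..T}. 0 \<le> \<omega> s t) \<and>
     (\<forall>s\<in>{S..T}. \<omega> s s = 0) \<and>
     (\<forall>s u t. S \<le> s \<longrightarrow> s \<le> u \<longrightarrow> u \<le> t \<longrightarrow> t \<le> T \<longrightarrow> \<omega> s u + \<omega> u t \<le> \<omega> s t)"

definition branched_rough_path ::
  "real \<Rightarrow> real \<Rightarrow> real \<Rightarrow> (real \<Rightarrow> real \<Rightarrow> real) \<Rightarrow> ('n forest \<Rightarrow> real \<Rightarrow> real \<Rightarrow> real) \<Rightarrow> bool" where
  "branched_rough_path S T p \<omega> X \<longleftrightarrow>
     (\<forall>\<alpha> \<beta> s u t. S \<le> s \<longrightarrow> s \<le> u \<longrightarrow> u \<le> t \<longrightarrow> t \<le> T \<longrightarrow>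
        X (Vertex \<alpha>) s t = X (Vertex \<alpha>) s u + X (Vertex \<alpha>) u t \<and>
        X (\<alpha> \<cdot>\<^sub>F \<beta>) s t = X (Vertex \<alpha>) s t * X (Vertex \<beta>) s t \<and>
        X (Ladder \<alpha> \<beta>) s t =
          X (Ladder \<alpha> \<beta>) s u + X (Ladder \<alpha> \<beta>) u t + X (Vertex \<alpha>) s u * X (Vertex \<beta>) u t) \<and>
     (\<exists>C>0. \<forall>\<alpha> \<beta>. \<forall>(s, t)\<in>simplex2 {S..T}.
        \<bar>X (Vertex \<alpha>) s t\<bar> \<le> C * \<omega> s t powr (1 / p) \<and>
        \<bar>X (\<alpha> \<cdot>\<^sub>F \<beta>) s t\<bar> \<le> C * \<omega> s t powr (2 / p) \<and>
        \<bar>X (Ladder \<alpha> \<beta>) s t\<bar> \<le> C * \<omega> s t powr (2 / p))"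


section \<open>The rough velocity bundle of Euclidean space\<close>

text \<open>A 2-jet at \<open>0\<close> of a map \<open>\<real>\<^sup>m \<rightarrow> \<real>\<^sup>m\<close> is given by its value (the target) and its first and
  second partial derivatives at \<open>0\<close>, the upper index coming first.\<close>

datatype 'm jet = Jet (target: "real^'m") (d1: "'m \<Rightarrow> 'm \<Rightarrow> real") (d2: "'m \<Rightarrow> 'm \<Rightarrow> 'm \<Rightarrow> real")

definition jet2 :: "(real^'m \<Rightarrow> real^'m) \<Rightarrow> 'm jet" where
  "jet2 \<psi> = Jet (\<psi> 0)
     (\<lambda>i j. partial j (\<lambda>z. \<psi> z $ i) 0)
     (\<lambda>i j k. partial j (partial k (\<lambda>z. \<psi> z $ i)) 0)"

type_synonym ('m, 'n) fiber = "'m \<Rightarrow> 'n forest \<Rightarrow> real"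

text \<open>The action of a jet on the model fiber.  Only the first and second derivatives matter.
  For a jet with symmetric second derivatives the equations for \<open>\<alpha>\<cdot>\<beta>\<close> and \<open>\<beta>\<cdot>\<alpha>\<close> coincide, so
  that exactly one \<open>g\<close> satisfies them.\<close>

definition act :: "'m::finite jet \<Rightarrow> ('m, 'n) fiber \<Rightarrow> ('m, 'n) fiber" where
  "act a f = (THE g. \<forall>i \<alpha> \<beta>.
     g i (Vertex \<alpha>) = (\<Sum>j\<in>UNIV. d1 a i j * f j (Vertex \<alpha>)) \<and>
     g i (\<alpha> \<cdot>\<^sub>F \<beta>) = (\<Sum>j\<in>UNIV. d1 a i j * f j (\<alpha> \<cdot>\<^sub>F \<beta>))
        + (\<Sum>j\<in>UNIV. \<Sum>k\<in>UNIV. d2 a i j k * f j (Vertex \<alpha>) * f k (Vertex \<beta>)) \<and>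
     g i (Ladder \<alpha> \<beta>) = (\<Sum>j\<in>UNIV. d1 a i j * f j (Ladder \<alpha> \<beta>)))"

definition frame_bundle2 :: "'m::finite jet set" where
  "frame_bundle2 = {jet2 \<psi> | \<psi>. local_diffeo_at_0 \<psi>}"

text \<open>\<open>(j\<^sup>2\<psi>, f) \<sim> (j\<^sup>2(\<psi> \<circ> a), a\<inverse>f)\<close> for \<open>a\<close> in the jet group; the condition
  \<open>act (jet2 a) g = f\<close> says \<open>g = a\<inverse>f\<close>.\<close>

definition frame_rel :: "(('m::finite jet \<times> ('m, 'n) fiber) \<times> ('m jet \<times> ('m, 'n) fiber)) set" where
  "frame_rel = {((jet2 \<psi>, f), (jet2 (\<psi> \<circ> a), g)) | \<psi> a f g.
     local_diffeo_at_0 \<psi> \<and> local_diffeo_at_0 a \<and> a 0 = 0 \<and> act (jet2 a) g = f}"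

type_synonym ('m, 'n) velocity = "('m jet \<times> ('m, 'n) fiber) set"

definition rough_velocity_bundle :: "('m::finite, 'n) velocity set" where
  "rough_velocity_bundle = (frame_bundle2 \<times> UNIV) // frame_rel"

definition bundle_proj :: "('m::finite, 'n) velocity \<Rightarrow> real^'m" where
  "bundle_proj c = the_elem ((\<lambda>(F, f). target F) ` c)"

text \<open>The fiber coordinates of a class induced by a chart \<open>x\<close> around its base point.\<close>

definition fiber_coords ::
  "(real^'m \<Rightarrow> real^'m) \<Rightarrow> ('m::finite, 'n) velocity \<Rightarrow> ('m, 'n) fiber" where
  "fiber_coords x c =
     the_elem {act (jet2 (x \<circ> \<psi>)) f | \<psi> f. local_diffeo_at_0 \<psi> \<and> (jet2 \<psi>, f) \<in> c}"


section \<open>Rough velocity fields and their integral curves\<close>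

definition rough_velocity_field :: "(real^'m \<Rightarrow> ('m::finite, 'n) velocity) \<Rightarrow> bool" where
  "rough_velocity_field f \<longleftrightarrow>
     (\<forall>p. f p \<in> rough_velocity_bundle \<and> bundle_proj (f p) = p) \<and>
     (\<forall>U x. chart U x \<longrightarrow> (\<forall>i \<tau>. smooth_on U (\<lambda>p. fiber_coords x (f p) i \<tau>)))"

definition field_support :: "(real^'m \<Rightarrow> ('m::finite, 'n) velocity) \<Rightarrow> (real^'m) set" where
  "field_support f =
     closure {p. \<exists>U x. chart U x \<and> p \<in> U \<and> (\<exists>i \<tau>. fiber_coords x (f p) i \<tau> \<noteq> 0)}"

definition admissible :: "(real^'m \<Rightarrow> ('m::finite, 'n) velocity) \<Rightarrow> bool" where
  "admissible f \<longleftrightarrow> (\<forall>p. \<exists>U x. chart U x \<and> p \<in> U \<and>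
     (\<forall>i \<alpha> \<beta>.
        (\<Sum>j\<in>UNIV. chart_partial U x j (\<lambda>q. fiber_coords x (f q) i (Vertex \<beta>)) p
            * fiber_coords x (f p) j (Vertex \<alpha>))
        = fiber_coords x (f p) i (\<alpha> \<cdot>\<^sub>F \<beta>) + fiber_coords x (f p) i (Ladder \<alpha> \<beta>)))"

definition integral_curve ::
  "real \<Rightarrow> real \<Rightarrow> real \<Rightarrow> (real \<Rightarrow> real \<Rightarrow> real) \<Rightarrow> ('n::finite forest \<Rightarrow> real \<Rightarrow> real \<Rightarrow> real)
    \<Rightarrow> (real^'m \<Rightarrow> ('m::finite, 'n) velocity) \<Rightarrow> (real \<Rightarrow> real^'m) \<Rightarrow> bool" where
  "integral_curve S T p \<omega> X f Y \<longleftrightarrow>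
     continuous_on {S..T} Y \<and>
     (\<forall>a b U x. a \<le> b \<longrightarrow> {a..b} \<subseteq> {S..T} \<longrightarrow> chart U x \<longrightarrow> Y ` {a..b} \<subseteq> U \<longrightarrow>
        (\<exists>C>0. \<forall>i. \<forall>(s, t)\<in>simplex2 {a..b}.
           \<bar>x (Y t) $ i - x (Y s) $ i
             - (\<Sum>\<tau>\<in>UNIV. 1 / sym_factor \<tau> * fiber_coords x (f (Y s)) i \<tau> * X \<tau> s t)\<bar>
           \<le> C * \<omega> s t powr (3 / p)))"

end

theory Submission
  imports Defs "HOL-Library.Landau_Symbols"
begin

text \<open>The transformation law of fiber coordinates makes admissibility independent of the chart, so in
  the standard chart of \<open>\<real>\<^sup>m\<close> the field is a family of smooth functions \<open>F\<^sub>\<tau>\<close> with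
  \<open>DF\<^sub>\<beta> F\<^sub>\<alpha> = F\<^sub>\<alpha>\<^sub>\<cdot>\<^sub>\<beta> + F\<^sub>\<alpha>\<^sub>|\<^sub>\<beta>\<close>.  Let \<open>Z = Y - Y'\<close> and let \<open>D(s,t)\<close> be the difference of the remainders in the
  expansions of \<open>Y\<close> and \<open>Y'\<close>; then \<open>D(S,t) = Z(t)\<close> since \<open>Z(S) = 0\<close>.  Taylor expansion, Chen's relation and
  admissibility bound \<open>D(s,t) - D(s,u) - D(u,t)\<close> by a multiple of
  \<open>|Z(s)| \<omega>(s,t)\<^bsup>3/p\<^esup> + |D(s,u)| \<omega>(s,t)\<^bsup>1/p\<^esup>\<close>.  If \<open>|D| \<le> N \<omega>\<^bsup>3/p\<^esup>\<close> on a short interval, then splitting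
  \<open>[s,t]\<close> where \<open>\<omega>\<close> halves gives the same bound with \<open>q N\<close> for a fixed \<open>q < 1\<close>, because \<open>3/p > 1\<close>.
  Hence \<open>D = 0\<close> and \<open>Z = 0\<close> there.\<close>


section \<open>Smooth functions\<close>

text \<open>Bounding the two remainders separately only yields the finite constant N with which the
  iteration starts. Contraction needs a defect bound linear in Z and D, so increments and Taylor
  remainders of the field are compared along two segments at once; for the Taylor remainders this
  takes third derivatives of F_\<beta>. The constants are uniform because all segments lie in the
  compact convex hull of the two curves. The loop closes because |Z(s)| = |D(S,s)| is itself
  controlled by N, with a spare power of \<omega>(S,s). Two terms are fed back, so q = 2^(1-3/p) + 2
  K \<omega>(S,R)^(1/p), where K is the constant of the defect bound: the first summand is below 1
  because p < 3, the second is made small by choosing R after K. On the geometric side,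
  \<open>act\<close>, \<open>bundle_proj\<close> and \<open>fiber_coords\<close> are unique-choice
  terms, which say nothing until existence and uniqueness are proved; symmetry of second derivatives
  supplies this for \<open>act\<close>, independence of the representative for the other
  two.\<close>

definition grad :: "(real^'m::finite \<Rightarrow> real) \<Rightarrow> real^'m \<Rightarrow> real^'m" where
  "grad \<phi> p = (\<chi> j. partial j \<phi> p)"

lemma grad_nth [simp]: "grad \<phi> p $ j = partial j \<phi> p"
  by (simp add: grad_def)

lemma frechet_derivative_eq_grad:
  fixes \<phi> :: "real^'m::finite \<Rightarrow> real"
  assumes "\<phi> differentiable (at p)"
  shows "frechet_derivative \<phi> (at p) v = grad \<phi> p \<bullet> v"
proof -
  let ?D = "frechet_derivative \<phi> (at p)"
  have lin: "linear ?D"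
    using assms by (rule linear_frechet_derivative)
  have "?D v = ?D (\<Sum>j\<in>UNIV. (v $ j) *\<^sub>R axis j 1)"
    using basis_expansion[of v] by (simp add: scalar_mult_eq_scaleR)
  also have "\<dots> = (\<Sum>j\<in>UNIV. v $ j * ?D (axis j 1))"
    using lin by (simp add: linear_sum linear_cmul)
  finally show ?thesis
    by (simp add: inner_vec_def partial_def mult.commute)
qed

lemma has_derivative_grad:
  fixes \<phi> :: "real^'m::finite \<Rightarrow> real"
  assumes "\<phi> differentiable (at p)"
  shows "(\<phi> has_derivative (\<lambda>v. grad \<phi> p \<bullet> v)) (at p)"
proof -
  have "frechet_derivative \<phi> (at p) = (\<lambda>v. grad \<phi> p \<bullet> v)"
    using frechet_derivative_eq_grad[OF assms] by blast
  then show ?thesis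
    using assms frechet_derivative_works by metis
qed

lemma partial_eqI:
  assumes "(\<phi> has_derivative D) (at p)"
  shows "partial j \<phi> p = D (axis j 1)"
  unfolding partial_def using frechet_derivative_at[OF assms] by simp

lemma partial_cong_eventually:
  fixes \<phi> \<psi> :: "real^'m::finite \<Rightarrow> real"
  assumes "open U" "p \<in> U" "\<And>z. z \<in> U \<Longrightarrow> \<phi> z = \<psi> z" "\<psi> differentiable (at p)"
  shows "partial j \<phi> p = partial j \<psi> p"
proof -
  have "(\<phi> has_derivative (\<lambda>v. grad \<psi> p \<bullet> v)) (at p)"
    using has_derivative_transform_within_open[OF has_derivative_grad[OF assms(4)] assms(1,2)] assms(3)
    by simp
  from partial_eqI[OF this] partial_eqI[OF has_derivative_grad[OF assms(4)]]
  show ?thesis by simp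
qed

lemma has_real_derivative_line:
  fixes \<phi> :: "real^'m::finite \<Rightarrow> real"
  assumes "\<phi> differentiable (at (c + x *\<^sub>R v))"
  shows "((\<lambda>r. \<phi> (c + r *\<^sub>R v)) has_real_derivative (grad \<phi> (c + x *\<^sub>R v) \<bullet> v)) (at x)"
proof -
  have "((\<lambda>r. c + r *\<^sub>R v) has_derivative (\<lambda>r. r *\<^sub>R v)) (at x)"
    by (auto intro!: derivative_eq_intros)
  then have "((\<lambda>r. \<phi> (c + r *\<^sub>R v)) has_derivative
      (\<lambda>r. grad \<phi> (c + x *\<^sub>R v) \<bullet> (r *\<^sub>R v))) (at x)"
    using has_derivative_grad[OF assms] by (rule has_derivative_compose)
  then show ?thesis
    by (simp add: has_field_derivative_def mult.commute[of _ "grad \<phi> (c + x *\<^sub>R v) \<bullet> v"] mult_commute_abs)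
qed

lemma smooth_onD:
  assumes "smooth_on U \<phi>"
  shows smooth_on_partial: "smooth_on U (partial j \<phi>)"
    and smooth_on_differentiable: "p \<in> U \<Longrightarrow> \<phi> differentiable (at p)"
    and smooth_on_continuous_on: "continuous_on U \<phi>"
proof -
  have Ck: "Ck_on k U \<phi>" for k
    using assms by (simp add: smooth_on_def)
  show "smooth_on U (partial j \<phi>)"
    unfolding smooth_on_def using Ck[of "Suc _"] by simp
  show "\<phi> differentiable (at p)" if "p \<in> U"
    using Ck[of "Suc 0"] that by simp
  show "continuous_on U \<phi>"
    using Ck[of 0] by simp
qed

lemma smooth_on_const [simp]: "smooth_on U (\<lambda>_. c)"
proof -
  have "Ck_on k U (\<lambda>_. c)" for k c
  proof (induction k arbitrary: c)
    case (Suc k)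
    have "partial j (\<lambda>_::real^'a. c) = (\<lambda>_. 0)" for j
      by (simp add: partial_def fun_eq_iff)
    with Suc show ?case by simp
  qed simp
  then show ?thesis by (simp add: smooth_on_def)
qed

lemma partial_nth: "partial j (\<lambda>z::real^'m::finite. z $ i) p = (if i = j then 1 else 0)"
proof -
  have "((\<lambda>z::real^'m. z $ i) has_derivative (\<lambda>z. z $ i)) (at p)"
    by (intro bounded_linear_imp_has_derivative bounded_linear_vec_nth)
  from partial_eqI[OF this] show ?thesis by (simp add: axis_def)
qed

lemma smooth_on_nth: "smooth_on U (\<lambda>z::real^'m::finite. z $ i)"
proof -
  have "Ck_on k U (\<lambda>z::real^'m. z $ i)" for k
  proof (cases k)
    case (Suc l)
    have "partial j (\<lambda>z::real^'m. z $ i) = (\<lambda>_. if i = j then 1 else 0)" for j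
      by (simp add: partial_nth fun_eq_iff)
    moreover have "(\<lambda>z::real^'m. z $ i) differentiable at p" for p
      by (intro bounded_linear_imp_differentiable bounded_linear_vec_nth)
    moreover have "Ck_on l U (\<lambda>_::real^'m. c)" for c
      using smooth_on_const[of U c] unfolding smooth_on_def by blast
    ultimately show ?thesis
      using Suc by simp
  qed (auto intro!: continuous_intros)
  then show ?thesis by (simp add: smooth_on_def)
qed

lemma chart_id: "chart UNIV (id :: real^'m::finite \<Rightarrow> real^'m)"
proof -
  have "the_inv_into UNIV id z = z" for z :: "real^'m"
    by (rule the_inv_into_f_eq) auto
  then show ?thesis
    by (simp add: chart_def smooth_map_on_def smooth_on_nth)
qed

text \<open>Both mixed partial derivatives are the limit of the same second difference quotient.\<close>

lemma second_difference_tendsto: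
  fixes \<phi> :: "real^'m::finite \<Rightarrow> real"
  assumes U: "open U" "p \<in> U" and \<phi>: "smooth_on U \<phi>"
  shows "((\<lambda>h. (\<phi> (p + h *\<^sub>R axis j 1 + h *\<^sub>R axis k 1) - \<phi> (p + h *\<^sub>R axis j 1)
      - \<phi> (p + h *\<^sub>R axis k 1) + \<phi> p) / h\<^sup>2) \<longlongrightarrow> partial k (partial j \<phi>) p) (at_right 0)"
    (is "((\<lambda>h. ?q h) \<longlongrightarrow> _) _")
proof (rule tendstoI)
  fix e :: real
  assume "e > 0"
  let ?G = "partial k (partial j \<phi>)"
  have "continuous_on U ?G"
    using \<phi> by (intro smooth_on_continuous_on smooth_on_partial)
  then have "isCont ?G p"
    using U continuous_on_eq_continuous_at by blast
  then obtain d1 where d1: "d1 > 0" "\<And>z. dist z p < d1 \<Longrightarrow> dist (?G z) (?G p) < e"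
    using \<open>e > 0\<close> unfolding continuous_at_eps_delta by blast
  obtain d2 where d2: "d2 > 0" "ball p d2 \<subseteq> U"
    using U open_contains_ball by blast
  \<comment> \<open>Halved, because displacements along two axes add up.\<close>
  define d where "d = min d1 d2 / 2"
  have "d > 0" using d1 d2 by (simp add: d_def)
  have close: "dist (p + a *\<^sub>R axis j 1 + b *\<^sub>R axis k 1) p < min d1 d2"
    if "0 \<le> a" "a < d" "0 \<le> b" "b < d" for a b
  proof -
    have "dist (p + a *\<^sub>R axis j 1 + b *\<^sub>R axis k 1) p \<le> norm (a *\<^sub>R axis j (1::real) :: real^'m) + norm (b *\<^sub>R axis k (1::real) :: real^'m)"
      unfolding dist_norm by (metis add.assoc add_diff_cancel_left' norm_triangle_ineq)
    also have "\<dots> < min d1 d2" using that unfolding d_def by (simp add: norm_axis_1)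
    finally show ?thesis .
  qed
  have inU: "p + a *\<^sub>R axis j 1 + b *\<^sub>R axis k 1 \<in> U"
    if "0 \<le> a" "a < d" "0 \<le> b" "b < d" for a b
    using close[OF that] d2(2) by (auto simp: dist_commute)
  have "dist (?q h) (?G p) < e" if h: "0 < h" "h < d" for h
  proof -
    \<comment> \<open>The mean value theorem in direction j, for the increment of \<phi> over h in
      direction k. A second application in direction k then acts on \<open>partial j \<phi>\<close>,
      so the second difference is exactly h^2 times a value of \<open>?G\<close> close to p, and
      continuity of \<open>?G\<close> finishes.\<close>
    have "\<exists>s. 0 < s \<and> s < h \<and>
      (\<phi> ((p + h *\<^sub>R axis k 1) + h *\<^sub>R axis j 1) - \<phi> (p + h *\<^sub>R axis j 1))
       - (\<phi> ((p + h *\<^sub>R axis k 1) + 0 *\<^sub>R axis j 1) - \<phi> (p + 0 *\<^sub>R axis j 1))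
       = (h - 0) * (grad \<phi> ((p + h *\<^sub>R axis k 1) + s *\<^sub>R axis j 1) \<bullet> axis j 1 - grad \<phi> (p + s *\<^sub>R axis j 1) \<bullet> axis j 1)"
    proof (rule MVT2[OF h(1)])
      fix x :: real assume x: "0 \<le> x" "x \<le> h"
      show "((\<lambda>a. \<phi> ((p + h *\<^sub>R axis k 1) + a *\<^sub>R axis j 1) - \<phi> (p + a *\<^sub>R axis j 1)) has_real_derivative
        (grad \<phi> ((p + h *\<^sub>R axis k 1) + x *\<^sub>R axis j 1) \<bullet> axis j 1 - grad \<phi> (p + x *\<^sub>R axis j 1) \<bullet> axis j 1)) (at x)"
        using inU[of x h] inU[of x 0] x h
        by (intro DERIV_diff has_real_derivative_line smooth_on_differentiable[OF \<phi>]) (simp_all add: algebra_simps)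
    qed
    then obtain s where s: "0 < s" "s < h" and s_eq:
      "\<phi> (p + h *\<^sub>R axis j 1 + h *\<^sub>R axis k 1) - \<phi> (p + h *\<^sub>R axis j 1) - \<phi> (p + h *\<^sub>R axis k 1) + \<phi> p
       = h * (partial j \<phi> (p + s *\<^sub>R axis j 1 + h *\<^sub>R axis k 1) - partial j \<phi> (p + s *\<^sub>R axis j 1))"
      by (auto simp: inner_axis algebra_simps)
    have "\<exists>t. 0 < t \<and> t < h \<and>
      partial j \<phi> ((p + s *\<^sub>R axis j 1) + h *\<^sub>R axis k 1) - partial j \<phi> ((p + s *\<^sub>R axis j 1) + 0 *\<^sub>R axis k 1)
       = (h - 0) * (grad (partial j \<phi>) ((p + s *\<^sub>R axis j 1) + t *\<^sub>R axis k 1) \<bullet> axis k 1)"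
    proof (rule MVT2[OF h(1)])
      fix x :: real assume x: "0 \<le> x" "x \<le> h"
      show "((\<lambda>a. partial j \<phi> ((p + s *\<^sub>R axis j 1) + a *\<^sub>R axis k 1)) has_real_derivative
        (grad (partial j \<phi>) ((p + s *\<^sub>R axis j 1) + x *\<^sub>R axis k 1) \<bullet> axis k 1)) (at x)"
        using inU[of s x] x h s
        by (intro has_real_derivative_line smooth_on_differentiable[OF smooth_on_partial[OF \<phi>]]) simp_all
    qed
    then obtain t where t: "0 < t" "t < h" and t_eq:
      "partial j \<phi> (p + s *\<^sub>R axis j 1 + h *\<^sub>R axis k 1) - partial j \<phi> (p + s *\<^sub>R axis j 1)
       = h * ?G (p + s *\<^sub>R axis j 1 + t *\<^sub>R axis k 1)"
      by (auto simp: inner_axis)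
    have "?q h = ?G (p + s *\<^sub>R axis j 1 + t *\<^sub>R axis k 1)"
      unfolding s_eq t_eq using h by (simp add: power2_eq_square)
    with d1(2)[of "p + s *\<^sub>R axis j 1 + t *\<^sub>R axis k 1"] close[of s t] s t h show ?thesis by simp
  qed
  then show "\<forall>\<^sub>F h in at_right 0. dist (?q h) (?G p) < e"
    using \<open>d > 0\<close> unfolding eventually_at_right_field by blast
qed

lemma partial_commute:
  fixes \<phi> :: "real^'m::finite \<Rightarrow> real"
  assumes U: "open U" "p \<in> U" and \<phi>: "smooth_on U \<phi>"
  shows "partial j (partial k \<phi>) p = partial k (partial j \<phi>) p"
proof (rule tendsto_unique)
  show "at_right (0::real) \<noteq> bot" by simp
  let ?q = "\<lambda>j k h. (\<phi> (p + h *\<^sub>R axis j 1 + h *\<^sub>R axis k 1) - \<phi> (p + h *\<^sub>R axis j 1)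
      - \<phi> (p + h *\<^sub>R axis k 1) + \<phi> p) / h\<^sup>2"
  show "(?q j k \<longlongrightarrow> partial k (partial j \<phi>) p) (at_right 0)"
    by (rule second_difference_tendsto[OF assms])
  have "?q k j = ?q j k"
    by (auto simp: fun_eq_iff algebra_simps)
  then show "(?q j k \<longlongrightarrow> partial j (partial k \<phi>) p) (at_right 0)"
    using second_difference_tendsto[OF assms, of k j] by simp
qed


section \<open>The rough velocity bundle in coordinates\<close>

lemma has_derivative_jacobian:
  fixes \<psi> :: "real^'m::finite \<Rightarrow> real^'m"
  assumes "smooth_map_on U \<psi>" "p \<in> U"
  shows "(\<psi> has_derivative (\<lambda>v. \<chi> i. grad (\<lambda>z. \<psi> z $ i) p \<bullet> v)) (at p)"
proof -
  have "((\<lambda>z. \<psi> z $ i) has_derivative (\<lambda>v. grad (\<lambda>z. \<psi> z $ i) p \<bullet> v)) (at p)" for i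
    using assms unfolding smooth_map_on_def by (intro has_derivative_grad smooth_on_differentiable[of U]) auto
  then show ?thesis
    by (subst has_derivative_componentwise_within) (auto simp: Basis_vec_def inner_axis)
qed

lemma smooth_map_on_continuous_on:
  fixes \<psi> :: "real^'m::finite \<Rightarrow> real^'m"
  assumes "smooth_map_on U \<psi>" "open U"
  shows "continuous_on U \<psi>"
  using has_derivative_continuous[OF has_derivative_jacobian[OF assms(1)]] assms(2)
  by (simp add: continuous_on_eq_continuous_at)

section \<open>2-jets at arbitrary source points, their composition and their action on the
  fiber\<close>

definition jet_at :: "(real^'m::finite \<Rightarrow> real^'m) \<Rightarrow> real^'m \<Rightarrow> 'm jet" where
  "jet_at \<psi> q = Jet (\<psi> q)
     (\<lambda>i j. partial j (\<lambda>z. \<psi> z $ i) q)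
     (\<lambda>i j k. partial j (partial k (\<lambda>z. \<psi> z $ i)) q)"

text \<open>The chain rule to second order: the inner Hessian pushed by the outer Jacobian, plus the
  outer Hessian evaluated on two inner Jacobian columns. The source of \<open>a\<close> is
  understood to be the target of \<open>b\<close>; the encoding does not check this.\<close>

definition jet_comp :: "'m::finite jet \<Rightarrow> 'm jet \<Rightarrow> 'm jet" where
  "jet_comp a b = Jet (target a)
     (\<lambda>i j. \<Sum>l\<in>UNIV. d1 a i l * d1 b l j)
     (\<lambda>i j k. (\<Sum>l\<in>UNIV. d1 a i l * d2 b l j k)
        + (\<Sum>l\<in>UNIV. \<Sum>m\<in>UNIV. d2 a i l m * d1 b l j * d1 b m k))"

text \<open>The type of jets does not enforce symmetry of second derivatives. Without it the
  equations for \<alpha>\<cdot>\<beta> and \<beta>\<cdot>\<alpha> in \<open>act\<close> may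
  contradict each other, so computations with \<open>act\<close> carry this predicate along.\<close>

definition sym_jet :: "'m::finite jet \<Rightarrow> bool" where
  "sym_jet a \<longleftrightarrow> (\<forall>i j k. d2 a i j k = d2 a i k j)"

lemma jet2_eq_jet_at: "jet2 \<psi> = jet_at \<psi> 0"
  by (simp add: jet2_def jet_at_def)

lemma jet_at_simps [simp]:
  "target (jet_at \<psi> q) = \<psi> q"
  "d1 (jet_at \<psi> q) i j = partial j (\<lambda>z. \<psi> z $ i) q"
  "d2 (jet_at \<psi> q) i j k = partial j (partial k (\<lambda>z. \<psi> z $ i)) q"
  by (simp_all add: jet_at_def)

lemma jet_comp_simps [simp]:
  "target (jet_comp a b) = target a"
  "d1 (jet_comp a b) i j = (\<Sum>l\<in>UNIV. d1 a i l * d1 b l j)"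
  "d2 (jet_comp a b) i j k = (\<Sum>l\<in>UNIV. d1 a i l * d2 b l j k)
        + (\<Sum>l\<in>UNIV. \<Sum>m\<in>UNIV. d2 a i l m * d1 b l j * d1 b m k)"
  by (simp_all add: jet_comp_def)

lemma sym_jet_at:
  assumes "smooth_map_on U \<psi>" "open U" "q \<in> U"
  shows "sym_jet (jet_at \<psi> q)"
  using assms unfolding sym_jet_def smooth_map_on_def by (simp add: partial_commute[of U])

lemma partial_comp:
  fixes x \<psi> :: "real^'m::finite \<Rightarrow> real^'m"
  assumes "smooth_map_on U x" "smooth_map_on W \<psi>" "z \<in> W" "\<psi> z \<in> U"
  shows "partial k (\<lambda>z. x (\<psi> z) $ i) z =
    (\<Sum>l\<in>UNIV. partial l (\<lambda>z. x z $ i) (\<psi> z) * partial k (\<lambda>z. \<psi> z $ l) z)"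
proof -
  have "((\<lambda>z. x z $ i) has_derivative (\<lambda>v. grad (\<lambda>z. x z $ i) (\<psi> z) \<bullet> v)) (at (\<psi> z))"
    using assms unfolding smooth_map_on_def by (intro has_derivative_grad smooth_on_differentiable[of U]) auto
  from has_derivative_compose[OF has_derivative_jacobian[OF assms(2,3)] this]
  show ?thesis
    by (simp add: partial_eqI inner_axis) (simp add: inner_vec_def)
qed

lemma jet_at_comp:
  fixes x \<psi> :: "real^'m::finite \<Rightarrow> real^'m"
  assumes x: "smooth_map_on U x" "open U" and \<psi>: "smooth_map_on W \<psi>" "open W"
    and z: "z \<in> W" "\<psi> z \<in> U"
  shows "jet_at (x \<circ> \<psi>) z = jet_comp (jet_at x (\<psi> z)) (jet_at \<psi> z)"
proof -
  let ?x = "\<lambda>i z. x z $ i" and ?\<psi> = "\<lambda>l z. \<psi> z $ l"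
  have sx: "smooth_on U (?x i)" and s\<psi>: "smooth_on W (?\<psi> i)" for i
    using x \<psi> by (auto simp: smooth_map_on_def)
  have "partial j (partial k (\<lambda>z. x (\<psi> z) $ i)) z =
     (\<Sum>l\<in>UNIV. partial l (?x i) (\<psi> z) * partial j (partial k (?\<psi> l)) z)
      + (\<Sum>l\<in>UNIV. \<Sum>m\<in>UNIV. partial l (partial m (?x i)) (\<psi> z) * partial j (?\<psi> l) z * partial k (?\<psi> m) z)"
    for i j k
  proof -
    let ?g = "\<lambda>z. \<Sum>m\<in>UNIV. partial m (?x i) (\<psi> z) * partial k (?\<psi> m) z"
    let ?D = "\<lambda>m v. grad (partial m (?x i)) (\<psi> z) \<bullet> (\<chi> l. grad (?\<psi> l) z \<bullet> v)"
    have "((\<lambda>z. partial m (?x i) (\<psi> z)) has_derivative ?D m) (at z)" for m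
      by (rule has_derivative_compose[OF has_derivative_jacobian[OF \<psi>(1) z(1)]])
        (intro has_derivative_grad smooth_on_differentiable[of U] smooth_on_partial sx z)
    moreover have "(partial k (?\<psi> m) has_derivative (\<lambda>v. grad (partial k (?\<psi> m)) z \<bullet> v)) (at z)" for m
      by (intro has_derivative_grad smooth_on_differentiable[of W] smooth_on_partial s\<psi> z)
    ultimately have D: "(?g has_derivative (\<lambda>v. \<Sum>m\<in>UNIV. partial m (?x i) (\<psi> z) * (grad (partial k (?\<psi> m)) z \<bullet> v)
        + ?D m v * partial k (?\<psi> m) z)) (at z)"
      by (intro has_derivative_sum has_derivative_mult)
    \<comment> \<open>The first-order chain rule is about to be differentiated again, so it must
      hold on a neighbourhood of z and not only at z.\<close>
    have "open (W \<inter> \<psi> -` U)"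
      using continuous_open_preimage[OF smooth_map_on_continuous_on[OF \<psi>]] \<psi>(2) x(2) by blast
    then have "partial j (partial k (\<lambda>z. x (\<psi> z) $ i)) z = partial j ?g z"
      using z partial_comp[OF x(1) \<psi>(1)] D
      by (intro partial_cong_eventually[of "W \<inter> \<psi> -` U"]) (auto simp: differentiable_def)
    also have "\<dots> = (\<Sum>m\<in>UNIV. partial m (?x i) (\<psi> z) * partial j (partial k (?\<psi> m)) z
        + (\<Sum>l\<in>UNIV. partial l (partial m (?x i)) (\<psi> z) * partial j (?\<psi> l) z) * partial k (?\<psi> m) z)"
      by (simp add: partial_eqI[OF D] inner_axis) (simp add: inner_vec_def)
    also have "\<dots> = (\<Sum>l\<in>UNIV. partial l (?x i) (\<psi> z) * partial j (partial k (?\<psi> l)) z)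
      + (\<Sum>m\<in>UNIV. \<Sum>l\<in>UNIV. partial l (partial m (?x i)) (\<psi> z) * partial j (?\<psi> l) z * partial k (?\<psi> m) z)"
      by (simp add: sum.distrib sum_distrib_right)
    also have "(\<Sum>m\<in>UNIV. \<Sum>l\<in>UNIV. partial l (partial m (?x i)) (\<psi> z) * partial j (?\<psi> l) z * partial k (?\<psi> m) z)
      = (\<Sum>l\<in>UNIV. \<Sum>m\<in>UNIV. partial l (partial m (?x i)) (\<psi> z) * partial j (?\<psi> l) z * partial k (?\<psi> m) z)"
      by (rule sum.swap)
    finally show ?thesis .
  qed
  then show ?thesis
    using partial_comp[OF x(1) \<psi>(1) z]
    by (simp add: jet_at_def jet_comp_def)
qed

text \<open>The unordered label is the only source of conflict. Exchanging the two sums and using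
  the symmetry of \<open>d2 a\<close> shows that the quadratic term is symmetric in \<alpha> and
  \<beta>; it therefore descends to a function \<open>c\<close> on unordered pairs, from which the
  witness is built.\<close>

lemma act_ex1:
  fixes a :: "'m::finite jet" and f :: "('m, 'n) fiber"
  assumes "sym_jet a"
  shows "\<exists>!g. \<forall>i \<alpha> \<beta>.
     g i (Vertex \<alpha>) = (\<Sum>j\<in>UNIV. d1 a i j * f j (Vertex \<alpha>)) \<and>
     g i (\<alpha> \<cdot>\<^sub>F \<beta>) = (\<Sum>j\<in>UNIV. d1 a i j * f j (\<alpha> \<cdot>\<^sub>F \<beta>))
        + (\<Sum>j\<in>UNIV. \<Sum>k\<in>UNIV. d2 a i j k * f j (Vertex \<alpha>) * f k (Vertex \<beta>)) \<and>
     g i (Ladder \<alpha> \<beta>) = (\<Sum>j\<in>UNIV. d1 a i j * f j (Ladder \<alpha> \<beta>))" (is "\<exists>!g. ?P g")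
proof -
  define q where "q i \<alpha> \<beta> =
    (\<Sum>j\<in>UNIV. \<Sum>k\<in>UNIV. d2 a i j k * f j (Vertex \<alpha>) * f k (Vertex \<beta>))" for i \<alpha> \<beta>
  have "q i \<alpha> \<beta> = q i \<beta> \<alpha>" for i \<alpha> \<beta>
  proof -
    have "q i \<alpha> \<beta> = (\<Sum>k\<in>UNIV. \<Sum>j\<in>UNIV. d2 a i j k * f j (Vertex \<alpha>) * f k (Vertex \<beta>))"
      unfolding q_def by (rule sum.swap)
    also have "\<dots> = q i \<beta> \<alpha>"
      using assms unfolding q_def sym_jet_def
      by (intro sum.cong refl) (metis mult.assoc mult.commute)
    finally show ?thesis .
  qed
  then have "\<forall>P. \<exists>c. \<forall>\<alpha> \<beta>. P = Upair \<alpha> \<beta> \<longrightarrow> c = q i \<alpha> \<beta>" for i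
    by (metis Upair_inject uprod_exhaust)
  then obtain c where c: "c i (Upair \<alpha> \<beta>) = q i \<alpha> \<beta>" for i \<alpha> \<beta>
    by metis
  let ?g = "\<lambda>i \<tau>. (\<Sum>j\<in>UNIV. d1 a i j * f j \<tau>) + (case \<tau> of Pair_Forest P \<Rightarrow> c i P | _ \<Rightarrow> 0)"
  have "?P ?g"
    by (simp add: c q_def)
  moreover have "g = ?g" if "?P g" for g
  proof (intro ext)
    fix i \<tau>
    show "g i \<tau> = ?g i \<tau>"
    proof (cases \<tau>)
      case (Pair_Forest P)
      with that show ?thesis by (cases P) (simp add: c q_def)
    qed (simp_all add: that)
  qed  ultimately show ?thesis by (rule ex1I)
qed

lemma act_simps:
  fixes f :: "('m::finite, 'n) fiber"
  assumes "sym_jet a"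
  shows act_Vertex: "act a f i (Vertex \<alpha>) = (\<Sum>j\<in>UNIV. d1 a i j * f j (Vertex \<alpha>))"
    and act_dot: "act a f i (\<alpha> \<cdot>\<^sub>F \<beta>) = (\<Sum>j\<in>UNIV. d1 a i j * f j (\<alpha> \<cdot>\<^sub>F \<beta>))
        + (\<Sum>j\<in>UNIV. \<Sum>k\<in>UNIV. d2 a i j k * f j (Vertex \<alpha>) * f k (Vertex \<beta>))"
    and act_Ladder: "act a f i (Ladder \<alpha> \<beta>) = (\<Sum>j\<in>UNIV. d1 a i j * f j (Ladder \<alpha> \<beta>))"
  using theI'[OF act_ex1[OF assms, of f]] unfolding act_def by blast+

lemma fiber_eqI:
  fixes f g :: "('m, 'n) fiber"
  assumes "\<And>i \<alpha>. f i (Vertex \<alpha>) = g i (Vertex \<alpha>)" "\<And>i \<alpha> \<beta>. f i (\<alpha> \<cdot>\<^sub>F \<beta>) = g i (\<alpha> \<cdot>\<^sub>F \<beta>)"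
    "\<And>i \<alpha> \<beta>. f i (Ladder \<alpha> \<beta>) = g i (Ladder \<alpha> \<beta>)"
  shows "f = g"
proof (intro ext)
  fix i \<tau>
  show "f i \<tau> = g i \<tau>"
  proof (cases \<tau>)
    case (Pair_Forest P)
    with assms show ?thesis by (cases P) simp
  qed (simp_all add: assms)
qed

lemma sym_jet_comp:
  assumes "sym_jet a" "sym_jet b"
  shows "sym_jet (jet_comp a b)"
proof -
  have s1: "(\<Sum>l\<in>UNIV. \<Sum>m\<in>UNIV. d2 a i l m * d1 b l j * d1 b m k)
      = (\<Sum>l\<in>UNIV. \<Sum>m\<in>UNIV. d2 a i l m * d1 b l k * d1 b m j)" for i j k
  proof -
    have "(\<Sum>l\<in>UNIV. \<Sum>m\<in>UNIV. d2 a i l m * d1 b l j * d1 b m k)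
      = (\<Sum>m\<in>UNIV. \<Sum>l\<in>UNIV. d2 a i l m * d1 b l j * d1 b m k)"
      by (rule sum.swap)
    also have "\<dots> = (\<Sum>l\<in>UNIV. \<Sum>m\<in>UNIV. d2 a i l m * d1 b l k * d1 b m j)"
      using assms(1) unfolding sym_jet_def by (intro sum.cong refl) (metis mult.assoc mult.commute)
    finally show ?thesis .
  qed
  have s2: "d2 b l j k = d2 b l k j" for l j k
    using assms(2) by (simp add: sym_jet_def)
  show ?thesis
    unfolding sym_jet_def jet_comp_simps
  proof (intro allI)
    fix i j k
    show "(\<Sum>l\<in>UNIV. d1 a i l * d2 b l j k) + (\<Sum>l\<in>UNIV. \<Sum>m\<in>UNIV. d2 a i l m * d1 b l j * d1 b m k)
      = (\<Sum>l\<in>UNIV. d1 a i l * d2 b l k j) + (\<Sum>l\<in>UNIV. \<Sum>m\<in>UNIV. d2 a i l m * d1 b l k * d1 b m j)"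
      by (simp only: s1[of i j k] s2[of _ j k])
  qed
qed

text \<open>The left action property on which the associated bundle rests. The two summands of the
  second-order chain rule match the two ways in which a Hessian arises: that of \<open>b\<close> is
  pushed by \<open>d1 a\<close>, that of \<open>a\<close> is evaluated on vectors already pushed by
  \<open>d1 b\<close>.\<close>

lemma act_jet_comp:
  fixes f :: "('m::finite, 'n) fiber"
  assumes a: "sym_jet a" and b: "sym_jet b"
  shows "act (jet_comp a b) f = act a (act b f)"
proof -
  note ab = sym_jet_comp[OF a b]
  have lin: "(\<Sum>j\<in>UNIV. (\<Sum>l\<in>UNIV. A l * B l j) * v j) = (\<Sum>l\<in>UNIV. A l * (\<Sum>j\<in>UNIV. B l j * v j))"
    for A :: "'m \<Rightarrow> real" and B and v :: "'m \<Rightarrow> real"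
    unfolding sum_distrib_left sum_distrib_right mult.assoc by (rule sum.swap)
  have lin2: "(\<Sum>j\<in>UNIV. \<Sum>k\<in>UNIV. (\<Sum>l\<in>UNIV. A l * B l j k) * v j * w k)
      = (\<Sum>l\<in>UNIV. A l * (\<Sum>j\<in>UNIV. \<Sum>k\<in>UNIV. B l j k * v j * w k))"
    for A :: "'m \<Rightarrow> real" and B and v w :: "'m \<Rightarrow> real"
  proof -
    have "(\<Sum>j\<in>UNIV. \<Sum>k\<in>UNIV. (\<Sum>l\<in>UNIV. A l * B l j k) * v j * w k)
      = (\<Sum>j\<in>UNIV. \<Sum>l\<in>UNIV. \<Sum>k\<in>UNIV. A l * (B l j k * v j * w k))"
      unfolding sum_distrib_right mult.assoc by (intro sum.cong refl sum.swap)
    also have "\<dots> = (\<Sum>l\<in>UNIV. \<Sum>j\<in>UNIV. \<Sum>k\<in>UNIV. A l * (B l j k * v j * w k))"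
      by (rule sum.swap)
    finally show ?thesis by (simp add: sum_distrib_left)
  qed
  have quad: "(\<Sum>j\<in>UNIV. \<Sum>k\<in>UNIV. (\<Sum>l\<in>UNIV. \<Sum>m\<in>UNIV. A l m * B l j * B m k) * v j * w k)
      = (\<Sum>l\<in>UNIV. \<Sum>m\<in>UNIV. A l m * (\<Sum>j\<in>UNIV. B l j * v j) * (\<Sum>k\<in>UNIV. B m k * w k))"
    for A :: "'m \<Rightarrow> 'm \<Rightarrow> real" and B and v w :: "'m \<Rightarrow> real"
  proof -
    \<comment> \<open>The factor 1 puts the outer sum into the shape of \<open>lin2\<close>, which
      is then applied once for l and once for m.\<close>
    have "(\<Sum>j\<in>UNIV. \<Sum>k\<in>UNIV. (\<Sum>l\<in>UNIV. \<Sum>m\<in>UNIV. A l m * B l j * B m k) * v j * w k)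
      = (\<Sum>j\<in>UNIV. \<Sum>k\<in>UNIV. (\<Sum>l\<in>UNIV. 1 * (\<Sum>m\<in>UNIV. A l m * (B l j * B m k))) * v j * w k)"
      by (simp add: mult.assoc)
    also have "\<dots> = (\<Sum>l\<in>UNIV. \<Sum>m\<in>UNIV. A l m * (\<Sum>j\<in>UNIV. \<Sum>k\<in>UNIV. (B l j * B m k) * v j * w k))"
      by (subst lin2, subst lin2) simp
    also have "\<dots> = (\<Sum>l\<in>UNIV. \<Sum>m\<in>UNIV. A l m * (\<Sum>j\<in>UNIV. B l j * v j) * (\<Sum>k\<in>UNIV. B m k * w k))"
      by (simp add: sum_product mult_ac)
    finally show ?thesis .
  qed
  show ?thesis
    by (rule fiber_eqI)
       (simp_all add: act_simps[OF a] act_simps[OF b] act_simps[OF ab] lin lin2 quad sum.distrib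
         distrib_right distrib_left)
qed

lemma act_jet_at_id:
  fixes f :: "('m::finite, 'n) fiber"
  shows "act (jet_at id q) f = f"
proof -
  have d1: "d1 (jet_at id q) i j = (if i = j then 1 else 0)"
    and d2: "d2 (jet_at id q) i j k = 0" for i j k :: 'm
  proof -
    show "d1 (jet_at id q) i j = (if i = j then 1 else 0)" by (simp add: partial_nth)
    have "partial k (\<lambda>z::real^'m. z $ i) = (\<lambda>_. if i = k then 1 else 0)"
      by (simp add: partial_nth fun_eq_iff)
    then show "d2 (jet_at id q) i j k = 0" by (simp add: partial_def)
  qed
  then have "sym_jet (jet_at id q)" unfolding sym_jet_def by simp
  then show ?thesis
    by (intro fiber_eqI) (simp_all add: act_simps d1 d2 if_distrib[where f="\<lambda>t. t * c" for c] cong: if_cong del: jet_at_simps)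
qed

section \<open>Change of charts and admissibility in standard coordinates\<close>

lemma chartD:
  assumes "chart U x"
  shows "open U" "smooth_map_on U x"
  using assms by (auto simp: chart_def)

lemma local_diffeoE:
  assumes "local_diffeo_at_0 \<psi>"
  obtains W where "0 \<in> W" "open W" "smooth_map_on W \<psi>"
  using assms by (auto simp: local_diffeo_at_0_def chart_def)

lemma sym_jet2:
  assumes "local_diffeo_at_0 \<psi>"
  shows "sym_jet (jet2 \<psi>)"
  using assms by (auto elim!: local_diffeoE simp: jet2_eq_jet_at intro: sym_jet_at)

text \<open>Every representative of the class gives the same value
  \<open>act (jet_at y q) (act (jet2 \<psi>0) g0)\<close>, so \<open>the_elem\<close> is applied to
  a singleton. For y = id the outer action is trivial, which identifies the inner expression with
  the standard coordinates.\<close>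

lemma fiber_coords_act:
  fixes c :: "('m::finite, 'n) velocity"
  assumes c: "c \<in> rough_velocity_bundle" and q: "bundle_proj c = q"
    and x: "chart U x" "q \<in> U"
  shows "fiber_coords x c = act (jet_at x q) (fiber_coords id c)"
proof -
  obtain \<psi>0 g0 where \<psi>0: "local_diffeo_at_0 \<psi>0" and c_eq: "c = frame_rel `` {(jet2 \<psi>0, g0)}"
    using c unfolding rough_velocity_bundle_def frame_bundle2_def by (auto elim!: quotientE)
  \<comment> \<open>The relation sees only jets: a member of the class is reached through some
    \<psi> with the same 2-jet as \<open>\<psi>0\<close>, not necessarily through
    \<open>\<psi>0\<close> itself.\<close>
  have c_iff: "(J, g) \<in> c \<longleftrightarrow> (\<exists>\<psi> a. jet2 \<psi>0 = jet2 \<psi> \<and> J = jet2 (\<psi> \<circ> a) \<and>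
      local_diffeo_at_0 \<psi> \<and> local_diffeo_at_0 a \<and> a 0 = 0 \<and> act (jet2 a) g = g0)" for J g
    unfolding c_eq frame_rel_def by auto
  have id: "local_diffeo_at_0 (id :: real^'m \<Rightarrow> real^'m)"
    unfolding local_diffeo_at_0_def using chart_id by blast
  \<comment> \<open>The generating pair belongs to its own class, with a = id; this makes the sets
    under \<open>the_elem\<close> nonempty.\<close>
  have rep: "(jet2 \<psi>0, g0) \<in> c"
    unfolding c_iff using \<psi>0 id act_jet_at_id[of 0 g0]
    by (intro exI[of _ \<psi>0] exI[of _ id]) (simp add: jet2_eq_jet_at)
  have target: "target J = \<psi>0 0" if "(J, g) \<in> c" for J g
    using that unfolding c_iff jet2_eq_jet_at by (metis comp_apply jet_at_simps(1))
  have "(\<lambda>(F, f). target F) ` c = {\<psi>0 0}"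
    using rep target by (force simp: image_iff)
  then have q_eq: "\<psi>0 0 = q"
    using q by (simp add: bundle_proj_def)
  have coords: "fiber_coords y c = act (jet_at y q) (act (jet2 \<psi>0) g0)" if y: "chart V y" "q \<in> V" for y V
  proof -
    note y' = chartD[OF y(1)]
    have *: "act (jet2 (y \<circ> \<phi>)) g = act (jet_at y q) (act (jet2 \<psi>0) g0)"
      if \<phi>: "local_diffeo_at_0 \<phi>" "(jet2 \<phi>, g) \<in> c" for \<phi> g
    proof -
      obtain \<psi> a where \<psi>: "jet2 \<psi>0 = jet2 \<psi>" "jet2 \<phi> = jet2 (\<psi> \<circ> a)" "local_diffeo_at_0 \<psi>"
        "local_diffeo_at_0 a" "a 0 = 0" "act (jet2 a) g = g0"
        using \<phi>(2) unfolding c_iff by blast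
      have "\<phi> 0 = q"
        using target[OF \<phi>(2)] q_eq by (simp add: jet2_eq_jet_at)
      obtain W where "0 \<in> W" "open W" "smooth_map_on W \<phi>"
        using local_diffeoE[OF \<phi>(1)] .
      then have "jet2 (y \<circ> \<phi>) = jet_comp (jet_at y q) (jet2 \<phi>)"
        unfolding jet2_eq_jet_at using \<open>\<phi> 0 = q\<close> y y' by (subst jet_at_comp[where U=V and W=W]) auto
      moreover have "jet2 \<phi> = jet_comp (jet2 \<psi>0) (jet2 a)"
      proof -
        obtain W where W: "0 \<in> W" "open W" "smooth_map_on W \<psi>"
          using local_diffeoE[OF \<psi>(3)] .
        obtain W' where W': "0 \<in> W'" "open W'" "smooth_map_on W' a"
          using local_diffeoE[OF \<psi>(4)] .
        show ?thesis
          unfolding \<psi>(1,2) unfolding jet2_eq_jet_at using W W' \<psi>(5)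
          by (subst jet_at_comp[where U=W and W=W']) auto
      qed
      ultimately have "jet2 (y \<circ> \<phi>) = jet_comp (jet_at y q) (jet_comp (jet2 \<psi>0) (jet2 a))"
        by simp
      then show ?thesis
        using sym_jet_at[OF y'(2,1) y(2)] sym_jet2[OF \<psi>0] sym_jet2[OF \<psi>(4)] \<psi>(6)
        by (simp add: act_jet_comp sym_jet_comp)
    qed
    have "{act (jet2 (y \<circ> \<phi>)) g | \<phi> g. local_diffeo_at_0 \<phi> \<and> (jet2 \<phi>, g) \<in> c}
        = {act (jet_at y q) (act (jet2 \<psi>0) g0)}"
      using * \<psi>0 rep by (auto intro: *[symmetric])
    then show ?thesis
      by (simp add: fiber_coords_def)
  qed
  show ?thesis
    using coords[OF x] coords[OF chart_id, simplified] act_jet_at_id by metis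
qed

text \<open>The chain rule for the inverse chart after x exhibits a left inverse of the Jacobian.
  This is what carries a vector identity from an arbitrary chart back to standard
  coordinates.\<close>

lemma chart_jacobian_injective:
  fixes x :: "real^'m::finite \<Rightarrow> real^'m"
  assumes x: "chart U x" "p \<in> U" and zero: "\<And>i. grad (\<lambda>z. x z $ i) p \<bullet> v = 0"
  shows "v = 0"
proof -
  let ?y = "the_inv_into U x"
  have sm: "open U" "smooth_map_on U x" "inj_on x U" "smooth_map_on (x ` U) ?y"
    using x by (auto simp: chart_def)
  have "((\<lambda>z. ?y (x z)) has_derivative
      (\<lambda>v. \<chi> i. grad (\<lambda>z. ?y z $ i) (x p) \<bullet> (\<chi> i. grad (\<lambda>z. x z $ i) p \<bullet> v))) (at p)"
    by (rule has_derivative_compose[OF has_derivative_jacobian[OF sm(2) x(2)]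
      has_derivative_jacobian[OF sm(4)]]) (use x in auto)
  moreover have "((\<lambda>z. ?y (x z)) has_derivative (\<lambda>v. v)) (at p)"
    by (rule has_derivative_transform_within_open[OF has_derivative_ident \<open>open U\<close> x(2)])
      (simp add: the_inv_into_f_f[OF sm(3)])
  ultimately have "(\<lambda>v. \<chi> i. grad (\<lambda>z. ?y z $ i) (x p) \<bullet> (\<chi> i. grad (\<lambda>z. x z $ i) p \<bullet> v)) = (\<lambda>v. v)"
    by (rule has_derivative_unique)
  from fun_cong[OF this, of v] show ?thesis
    using zero by (simp add: vec_eq_iff inner_vec_def)
qed

text \<open>The chain rule for G written as G after the inverse chart after x. Chart derivatives
  contracted with the Jacobian image of v become a directional derivative in standard
  coordinates.\<close>

lemma chart_partial_sum:
  fixes x :: "real^'m::finite \<Rightarrow> real^'m"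
  assumes x: "chart U x" "p \<in> U" and G: "G differentiable (at p)"
  shows "(\<Sum>j\<in>UNIV. chart_partial U x j G p * (grad (\<lambda>z. x z $ j) p \<bullet> v)) = grad G p \<bullet> v"
proof -
  let ?y = "the_inv_into U x"
  have sm: "open U" "smooth_map_on U x" "inj_on x U" "smooth_map_on (x ` U) ?y"
    using x by (auto simp: chart_def)
  have yx: "?y (x z) = z" if "z \<in> U" for z
    using that by (rule the_inv_into_f_f[OF sm(3)])
  have "x p \<in> x ` U" using x by auto
  have "G differentiable (at (?y (x p)))" using yx[OF x(2)] G by simp
  then have "((\<lambda>z. G (?y z)) differentiable (at (x p)))"
    using has_derivative_compose[OF has_derivative_jacobian[OF sm(4) \<open>x p \<in> x ` U\<close>] has_derivative_grad]
    unfolding differentiable_def by blast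
  then have "((\<lambda>z. G (?y (x z))) has_derivative
      (\<lambda>v. grad (G \<circ> ?y) (x p) \<bullet> (\<chi> j. grad (\<lambda>z. x z $ j) p \<bullet> v))) (at p)"
    using has_derivative_compose[OF has_derivative_jacobian[OF sm(2) x(2)] has_derivative_grad]
    by (simp add: o_def)
  then have "(G has_derivative
      (\<lambda>v. grad (G \<circ> ?y) (x p) \<bullet> (\<chi> j. grad (\<lambda>z. x z $ j) p \<bullet> v))) (at p)"
    by (rule has_derivative_transform_within_open[OF _ sm(1) x(2)]) (simp add: yx)
  from fun_cong[OF has_derivative_unique[OF this has_derivative_grad[OF G]], of v]
  show ?thesis
    by (simp add: chart_partial_def inner_vec_def)
qed

text \<open>Along F_\<alpha> the transformed coordinate sum_k (d_k x^i) F^k_\<beta> has as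
  derivative the Jacobian applied to DF_\<beta> F_\<alpha>, plus D^2 x^i (F_\<alpha>, F_\<beta>).
  The second term is precisely what the jet action adds to the \<alpha>\<cdot>\<beta> coordinate. It
  cancels, so the Jacobian annihilates the defect vector \<open>e\<close>, which is therefore
  zero.\<close>

lemma admissible_standard_coords:
  fixes f :: "real^'m::finite \<Rightarrow> ('m, 'n) velocity"
  assumes f: "rough_velocity_field f" and adm: "admissible f"
  defines "F \<equiv> \<lambda>i \<tau> q. fiber_coords id (f q) i \<tau>"
  shows "(\<Sum>j\<in>UNIV. partial j (F i (Vertex \<beta>)) p * F j (Vertex \<alpha>) p)
    = F i (\<alpha> \<cdot>\<^sub>F \<beta>) p + F i (Ladder \<alpha> \<beta>) p"
proof -
  obtain U x where x: "chart U x" "p \<in> U" and adm_x: "\<And>i \<alpha> \<beta>.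
        (\<Sum>j\<in>UNIV. chart_partial U x j (\<lambda>q. fiber_coords x (f q) i (Vertex \<beta>)) p
            * fiber_coords x (f p) j (Vertex \<alpha>))
        = fiber_coords x (f p) i (\<alpha> \<cdot>\<^sub>F \<beta>) + fiber_coords x (f p) i (Ladder \<alpha> \<beta>)"
    using adm[unfolded admissible_def, rule_format, of p] by blast
  note x' = chartD[OF x(1)]
  have F_diff: "F i \<tau> differentiable (at q)" for i \<tau> q
  proof -
    have "smooth_on UNIV (F i \<tau>)"
      using f chart_id unfolding rough_velocity_field_def F_def by blast
    then show ?thesis by (rule smooth_on_differentiable) simp
  qed
  have x_smooth: "smooth_on U (\<lambda>z. x z $ i)" for i
    using x' by (simp add: smooth_map_on_def)
  have coords: "fiber_coords x (f q) = act (jet_at x q) (\<lambda>i \<tau>. F i \<tau> q)" if "q \<in> U" for q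
    using fiber_coords_act[OF _ _ x(1) that, of "f q"] f
    unfolding rough_velocity_field_def F_def by simp
  have sym: "sym_jet (jet_at x q)" if "q \<in> U" for q
    using sym_jet_at x' that by blast
  define \<xi> where "\<xi> \<gamma> = (\<chi> k. F k (Vertex \<gamma>) p)" for \<gamma>
  define e where "e = (\<chi> k. (\<Sum>j\<in>UNIV. partial j (F k (Vertex \<beta>)) p * F j (Vertex \<alpha>) p)
    - F k (\<alpha> \<cdot>\<^sub>F \<beta>) p - F k (Ladder \<alpha> \<beta>) p)"
  have "grad (\<lambda>z. x z $ i) p \<bullet> e = 0" for i
  proof -
    let ?G = "\<lambda>q. fiber_coords x (f q) i (Vertex \<beta>)"
    let ?H = "\<lambda>q. \<Sum>k\<in>UNIV. partial k (\<lambda>z. x z $ i) q * F k (Vertex \<beta>) q"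
    have GH: "?G q = ?H q" if "q \<in> U" for q
      by (simp add: coords[OF that] act_Vertex[OF sym[OF that]])
    have "(?H has_derivative (\<lambda>v. \<Sum>k\<in>UNIV. partial k (\<lambda>z. x z $ i) p * (grad (F k (Vertex \<beta>)) p \<bullet> v)
        + (grad (partial k (\<lambda>z. x z $ i)) p \<bullet> v) * F k (Vertex \<beta>) p)) (at p)"
      by (intro has_derivative_sum has_derivative_mult has_derivative_grad F_diff
          smooth_on_differentiable[of U] smooth_on_partial x_smooth x(2))
    from has_derivative_transform_within_open[OF this x'(1) x(2)]
    have DG: "(?G has_derivative (\<lambda>v. \<Sum>k\<in>UNIV. partial k (\<lambda>z. x z $ i) p * (grad (F k (Vertex \<beta>)) p \<bullet> v)
        + (grad (partial k (\<lambda>z. x z $ i)) p \<bullet> v) * F k (Vertex \<beta>) p)) (at p)"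
      using GH by simp
    then have "?G differentiable (at p)" unfolding differentiable_def by blast
    note grad_G = fun_cong[OF has_derivative_unique[OF DG has_derivative_grad[OF this]], of "\<xi> \<alpha>"]
    have "fiber_coords x (f p) j (Vertex \<alpha>) = grad (\<lambda>z. x z $ j) p \<bullet> \<xi> \<alpha>" for j
      by (simp add: coords[OF x(2)] act_Vertex[OF sym[OF x(2)]] inner_vec_def \<xi>_def)
    then have "grad ?G p \<bullet> \<xi> \<alpha> = fiber_coords x (f p) i (\<alpha> \<cdot>\<^sub>F \<beta>) + fiber_coords x (f p) i (Ladder \<alpha> \<beta>)"
      using adm_x[where i=i and \<alpha>=\<alpha> and \<beta>=\<beta>] chart_partial_sum[OF x \<open>?G differentiable (at p)\<close>, of "\<xi> \<alpha>"] by simp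
    also have "\<dots> = (\<Sum>j\<in>UNIV. partial j (\<lambda>z. x z $ i) p * F j (\<alpha> \<cdot>\<^sub>F \<beta>) p)
        + (\<Sum>j\<in>UNIV. \<Sum>k\<in>UNIV. partial j (partial k (\<lambda>z. x z $ i)) p * F j (Vertex \<alpha>) p * F k (Vertex \<beta>) p)
        + (\<Sum>j\<in>UNIV. partial j (\<lambda>z. x z $ i) p * F j (Ladder \<alpha> \<beta>) p)"
      by (simp add: coords[OF x(2)] act_dot[OF sym[OF x(2)]] act_Ladder[OF sym[OF x(2)]])
    \<comment> \<open>Reordered so that the index j, the direction of differentiation along
      F_\<alpha>, is innermost, as the product rule delivers it.\<close>
    also have "(\<Sum>j\<in>UNIV. \<Sum>k\<in>UNIV. partial j (partial k (\<lambda>z. x z $ i)) p * F j (Vertex \<alpha>) p * F k (Vertex \<beta>) p)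
       = (\<Sum>k\<in>UNIV. \<Sum>j\<in>UNIV. partial j (partial k (\<lambda>z. x z $ i)) p * F j (Vertex \<alpha>) p * F k (Vertex \<beta>) p)"
      by (rule sum.swap)
    finally show ?thesis
      using grad_G by (simp add: inner_vec_def e_def \<xi>_def sum.distrib sum_distrib_right
        sum_subtractf right_diff_distrib)
  qed
  from chart_jacobian_injective[OF x this] have "e = 0" .
  from arg_cong[OF this, of "\<lambda>v. v $ i"] show ?thesis by (simp add: e_def)
qed


section \<open>Sums over forests and second differences\<close>

text \<open>Orbit counting: the fiber of the map from ordered to unordered pairs over P has 2 /
  \<sigma>(P) elements. Sums weighted by the symmetry factor thus become half of a sum over ordered
  pairs.\<close>

lemma sum_uprod_sym_factor:
  fixes \<psi> :: "'n::finite uprod \<Rightarrow> real"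
  shows "(\<Sum>P\<in>UNIV. 1 / sym_factor (Pair_Forest P) * \<psi> P) = (\<Sum>\<alpha>\<in>UNIV. \<Sum>\<beta>\<in>UNIV. \<psi> (Upair \<alpha> \<beta>)) / 2"
proof -
  let ?h = "\<lambda>(\<alpha>, \<beta>). \<psi> (Upair \<alpha> \<beta>)" and ?g = "\<lambda>(\<alpha>, \<beta>). Upair \<alpha> (\<beta> :: 'n)"
  have "sum ?h {x \<in> UNIV. ?g x = P} = 2 / sym_factor (Pair_Forest P) * \<psi> P" for P
  proof (cases P)
    case (Upair a b)
    then have *: "{x \<in> UNIV. ?g x = P} = {(a, b), (b, a)}" by auto
    show ?thesis
    proof (cases "a = b")
      case True
      then have "\<exists>\<alpha>. P = Upair \<alpha> \<alpha>" using Upair by blast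
      then show ?thesis unfolding * using True Upair by simp
    next
      case False
      then have "\<nexists>\<alpha>. P = Upair \<alpha> \<alpha>" and "\<psi> (Upair b a) = \<psi> P" using Upair False
        by (auto intro: arg_cong[of _ _ \<psi>])
      then show ?thesis unfolding * using False Upair by simp
    qed
  qed
  then have "(\<Sum>P\<in>UNIV. 2 / sym_factor (Pair_Forest P) * \<psi> P) = sum ?h UNIV"
    using sum.group[of UNIV UNIV ?g ?h] by simp
  also have "\<dots> = (\<Sum>\<alpha>\<in>UNIV. \<Sum>\<beta>\<in>UNIV. \<psi> (Upair \<alpha> \<beta>))"
    by (simp add: sum.cartesian_product)
  finally have "(\<Sum>P\<in>UNIV. 2 / sym_factor (Pair_Forest P) * \<psi> P) = (\<Sum>\<alpha>\<in>UNIV. \<Sum>\<beta>\<in>UNIV. \<psi> (Upair \<alpha> \<beta>))" .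
  moreover have "(\<Sum>P\<in>UNIV. 2 / sym_factor (Pair_Forest P) * \<psi> P)
      = 2 * (\<Sum>P\<in>UNIV. 1 / sym_factor (Pair_Forest P) * \<psi> P)"
    unfolding sum_distrib_left by (intro sum.cong refl) (simp del: sym_factor.simps)
  ultimately show ?thesis by linarith
qed

lemma sum_forest_sym_factor:
  fixes \<phi> :: "'n::finite forest \<Rightarrow> real"
  shows "(\<Sum>\<tau>\<in>UNIV. 1 / sym_factor \<tau> * \<phi> \<tau>) = (\<Sum>\<alpha>\<in>UNIV. \<phi> (Vertex \<alpha>))
    + (\<Sum>\<alpha>\<in>UNIV. \<Sum>\<beta>\<in>UNIV. \<phi> (\<alpha> \<cdot>\<^sub>F \<beta>)) / 2 + (\<Sum>\<alpha>\<in>UNIV. \<Sum>\<beta>\<in>UNIV. \<phi> (Ladder \<alpha> \<beta>))"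
proof -
  let ?f = "\<lambda>\<tau>. 1 / sym_factor \<tau> * \<phi> \<tau>" and ?L = "\<lambda>(\<alpha>, \<beta>). Ladder \<alpha> (\<beta> :: 'n)"
  have UNIV: "(UNIV :: 'n forest set) = (range Vertex \<union> range Pair_Forest) \<union> range ?L"
  proof -
    have "\<tau> \<in> (range Vertex \<union> range Pair_Forest) \<union> range ?L" for \<tau> :: "'n forest"
      by (cases \<tau>) auto
    then show ?thesis by blast
  qed
  have "sum ?f UNIV = sum ?f (range Vertex) + sum ?f (range Pair_Forest) + sum ?f (range ?L)"
    unfolding UNIV by (subst sum.union_disjoint, simp, simp, force)+ simp
  also have "sum ?f (range Vertex) = (\<Sum>\<alpha>\<in>UNIV. \<phi> (Vertex \<alpha>))"
    by (subst sum.reindex) (auto intro: injI)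
  also have "sum ?f (range Pair_Forest) = (\<Sum>P\<in>UNIV. 1 / sym_factor (Pair_Forest P) * \<phi> (Pair_Forest P))"
    by (subst sum.reindex) (auto intro: injI)
  also have "sum ?f (range ?L) = (\<Sum>\<alpha>\<in>UNIV. \<Sum>\<beta>\<in>UNIV. \<phi> (Ladder \<alpha> \<beta>))"
    by (subst sum.reindex) (auto intro!: injI simp: sum.cartesian_product o_def case_prod_unfold)
  finally show ?thesis
    by (simp only: sum_uprod_sym_factor)
qed

section \<open>Increments and Taylor remainders, compared along two segments\<close>

lemma increment_le_derivative_bound:
  fixes \<phi> :: "real \<Rightarrow> real"
  assumes "\<And>x. 0 \<le> x \<Longrightarrow> x \<le> 1 \<Longrightarrow> (\<phi> has_real_derivative \<phi>' x) (at x)"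
    and "\<And>x. 0 \<le> x \<Longrightarrow> x \<le> 1 \<Longrightarrow> \<bar>\<phi>' x\<bar> \<le> K"
  shows "\<bar>\<phi> 1 - \<phi> 0\<bar> \<le> K"
proof -
  obtain x where "0 < x" "x < 1" "\<phi> 1 - \<phi> 0 = (1 - 0) * \<phi>' x"
    using MVT2[of 0 1 \<phi> \<phi>'] assms(1) by auto
  then show ?thesis using assms(2)[of x] by simp
qed

lemma segment_in_convex:
  fixes a b :: "'a::real_vector"
  assumes "convex B" "a \<in> B" "b \<in> B" "0 \<le> x" "x \<le> 1"
  shows "a + x *\<^sub>R (b - a) \<in> B"
  using convexD_alt[OF assms] by (simp add: algebra_simps)

lemma smooth_bounded:
  fixes g :: "real^'m::finite \<Rightarrow> real"
  assumes "smooth_on UNIV g" "compact B"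
  obtains K where "0 \<le> K" "\<And>p. p \<in> B \<Longrightarrow> \<bar>g p\<bar> \<le> K"
proof -
  have "bounded (g ` B)"
    using compact_continuous_image[OF continuous_on_subset[OF smooth_on_continuous_on[OF assms(1)]] assms(2)]
      compact_imp_bounded by blast
  then obtain K where "\<forall>y\<in>g ` B. norm y \<le> K" unfolding bounded_iff by blast
  then show ?thesis using that[of "max 0 K"] by fastforce
qed

lemma grad_bounded:
  fixes g :: "real^'m::finite \<Rightarrow> real"
  assumes "smooth_on UNIV g" "compact B"
  obtains K where "0 \<le> K" "\<And>p. p \<in> B \<Longrightarrow> norm (grad g p) \<le> K"
proof -
  have "continuous_on B (grad g)"
    unfolding grad_def using assms(1)
    by (intro continuous_on_vec_lambda continuous_on_subset[OF smooth_on_continuous_on[OF smooth_on_partial]]) auto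
  then have "bounded (grad g ` B)"
    using compact_continuous_image assms(2) compact_imp_bounded by blast
  then obtain K where "\<forall>y\<in>grad g ` B. norm y \<le> K" unfolding bounded_iff by blast
  then show ?thesis using that[of "max 0 K"] by fastforce
qed

lemma smooth_lipschitz:
  fixes g :: "real^'m::finite \<Rightarrow> real"
  assumes g: "smooth_on UNIV g" and B: "compact B" "convex B"
  obtains K where "0 \<le> K" "\<And>a b. a \<in> B \<Longrightarrow> b \<in> B \<Longrightarrow> \<bar>g b - g a\<bar> \<le> K * norm (b - a)"
proof -
  obtain K where K: "0 \<le> K" "\<And>p. p \<in> B \<Longrightarrow> norm (grad g p) \<le> K"
    using grad_bounded[OF g B(1)] by blast
  have "\<bar>g b - g a\<bar> \<le> K * norm (b - a)" if "a \<in> B" "b \<in> B" for a b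
  proof -
    have "\<bar>g (a + 1 *\<^sub>R (b - a)) - g (a + 0 *\<^sub>R (b - a))\<bar> \<le> K * norm (b - a)"
    proof (rule increment_le_derivative_bound)
      fix x :: real assume x: "0 \<le> x" "x \<le> 1"
      show "((\<lambda>x. g (a + x *\<^sub>R (b - a))) has_real_derivative grad g (a + x *\<^sub>R (b - a)) \<bullet> (b - a)) (at x)"
        by (intro has_real_derivative_line smooth_on_differentiable[OF g]) simp
      show "\<bar>grad g (a + x *\<^sub>R (b - a)) \<bullet> (b - a)\<bar> \<le> K * norm (b - a)"
        using K(2)[OF segment_in_convex[OF B(2) that x]]
        by (meson Cauchy_Schwarz_ineq2 mult_right_mono norm_ge_zero order_trans)
    qed
    then show ?thesis by simp
  qed
  then show ?thesis using that K(1) by blast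
qed

lemma grad_lipschitz:
  fixes g :: "real^'m::finite \<Rightarrow> real"
  assumes g: "smooth_on UNIV g" and B: "compact B" "convex B"
  obtains K where "0 \<le> K" "\<And>a b. a \<in> B \<Longrightarrow> b \<in> B \<Longrightarrow> norm (grad g b - grad g a) \<le> K * norm (b - a)"
proof -
  have "\<exists>K. 0 \<le> K \<and> (\<forall>a\<in>B. \<forall>b\<in>B. \<bar>partial j g b - partial j g a\<bar> \<le> K * norm (b - a))" for j
    using smooth_lipschitz[OF smooth_on_partial[OF g] B, of j] by metis
  then obtain K where K: "\<And>j. 0 \<le> K j"
    "\<And>j a b. a \<in> B \<Longrightarrow> b \<in> B \<Longrightarrow> \<bar>partial j g b - partial j g a\<bar> \<le> K j * norm (b - a)"
    by metis
  show ?thesis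
  proof (rule that)
    show "0 \<le> (\<Sum>j\<in>UNIV. K j)" using K(1) by (simp add: sum_nonneg)
    fix a b assume "a \<in> B" "b \<in> B"
    have "norm (grad g b - grad g a) \<le> (\<Sum>j\<in>UNIV. \<bar>(grad g b - grad g a) $ j\<bar>)"
      by (rule norm_le_l1_cart)
    also have "\<dots> \<le> (\<Sum>j\<in>UNIV. K j * norm (b - a))"
      using K(2)[OF \<open>a \<in> B\<close> \<open>b \<in> B\<close>] by (intro sum_mono) simp
    finally show "norm (grad g b - grad g a) \<le> (\<Sum>j\<in>UNIV. K j) * norm (b - a)"
      by (simp add: sum_distrib_right)
  qed
qed

definition taylor_rem :: "(real^'m::finite \<Rightarrow> real) \<Rightarrow> real^'m \<Rightarrow> real^'m \<Rightarrow> real" where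
  "taylor_rem g a b = g b - g a - grad g a \<bullet> (b - a)"

lemma taylor_rem_bound:
  fixes g :: "real^'m::finite \<Rightarrow> real"
  assumes g: "smooth_on UNIV g" and B: "compact B" "convex B"
  obtains K where "0 \<le> K" "\<And>a b. a \<in> B \<Longrightarrow> b \<in> B \<Longrightarrow> \<bar>taylor_rem g a b\<bar> \<le> K * (norm (b - a))\<^sup>2"
proof -
  obtain K where K: "0 \<le> K" "\<And>a b. a \<in> B \<Longrightarrow> b \<in> B \<Longrightarrow> norm (grad g b - grad g a) \<le> K * norm (b - a)"
    using grad_lipschitz[OF g B] by blast
  have "\<bar>taylor_rem g a b\<bar> \<le> K * (norm (b - a))\<^sup>2" if "a \<in> B" "b \<in> B" for a b
  proof -
    let ?\<phi> = "\<lambda>x. g (a + x *\<^sub>R (b - a)) - x * (grad g a \<bullet> (b - a))"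
    have "\<bar>?\<phi> 1 - ?\<phi> 0\<bar> \<le> K * (norm (b - a))\<^sup>2"
    proof (rule increment_le_derivative_bound)
      fix x :: real assume x: "0 \<le> x" "x \<le> 1"
      let ?y = "a + x *\<^sub>R (b - a)"
      show "(?\<phi> has_real_derivative grad g ?y \<bullet> (b - a) - grad g a \<bullet> (b - a)) (at x)"
        by (intro DERIV_diff has_real_derivative_line smooth_on_differentiable[OF g])
          (auto intro!: derivative_eq_intros)
      have "norm (grad g ?y - grad g a) \<le> K * norm (?y - a)"
        using K(2)[OF that(1) segment_in_convex[OF B(2) that x]] .
      also have "\<dots> \<le> K * norm (b - a)"
        using x K(1) by (intro mult_left_mono) (auto intro: mult_left_le_one_le)
      finally have "norm (grad g ?y - grad g a) * norm (b - a) \<le> K * norm (b - a) * norm (b - a)"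
        by (rule mult_right_mono) simp
      then show "\<bar>grad g ?y \<bullet> (b - a) - grad g a \<bullet> (b - a)\<bar> \<le> K * (norm (b - a))\<^sup>2"
        using Cauchy_Schwarz_ineq2[of "grad g ?y - grad g a" "b - a"]
        by (simp add: inner_diff_left power2_eq_square mult.assoc)
    qed
    then show ?thesis by (simp add: taylor_rem_def)
  qed
  then show ?thesis using that K(1) by blast
qed

lemma norm_convex_combination_le:
  fixes h h' :: "'a::real_normed_vector"
  assumes "0 \<le> x" "x \<le> 1"
  shows "norm (h' + x *\<^sub>R (h - h')) \<le> norm h + norm h'"
proof -
  have "norm (h' + x *\<^sub>R (h - h')) = norm (x *\<^sub>R h + (1 - x) *\<^sub>R h')"
    by (simp add: algebra_simps)
  also have "\<dots> \<le> x * norm h + (1 - x) * norm h'"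
    using norm_triangle_ineq[of "x *\<^sub>R h" "(1 - x) *\<^sub>R h'"] assms by simp
  also have "\<dots> \<le> 1 * norm h + 1 * norm h'"
    using assms by (intro add_mono mult_right_mono) auto
  finally show ?thesis by simp
qed

text \<open>The pair (a', b') is moved linearly to (a, b), through (y, z). The derivative of g(z) -
  g(y) splits into grad g(z) applied to the difference of the increments, and (grad g(z) - grad
  g(y)) applied to a - a'; the Lipschitz bound on the gradient gives the latter its extra factor |z
  - y|.\<close>

lemma increment_difference_bound:
  fixes g :: "real^'m::finite \<Rightarrow> real"
  assumes g: "smooth_on UNIV g" and B: "compact B" "convex B"
  obtains K where "0 \<le> K" "\<And>a b a' b'. a \<in> B \<Longrightarrow> b \<in> B \<Longrightarrow> a' \<in> B \<Longrightarrow> b' \<in> B \<Longrightarrow>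
    \<bar>(g b - g a) - (g b' - g a')\<bar>
      \<le> K * (norm ((b - a) - (b' - a')) + norm (a - a') * (norm (b - a) + norm (b' - a')))"
proof -
  obtain K0 where K0: "0 \<le> K0" "\<And>p. p \<in> B \<Longrightarrow> norm (grad g p) \<le> K0"
    using grad_bounded[OF g B(1)] by blast
  obtain K1 where K1: "0 \<le> K1" "\<And>a b. a \<in> B \<Longrightarrow> b \<in> B \<Longrightarrow> norm (grad g b - grad g a) \<le> K1 * norm (b - a)"
    using grad_lipschitz[OF g B] by blast
  show ?thesis
  proof (rule that[of "K0 + K1"])
    show "0 \<le> K0 + K1" using K0(1) K1(1) by simp
    fix a b a' b' assume ab: "a \<in> B" "b \<in> B" "a' \<in> B" "b' \<in> B"
    let ?y = "\<lambda>x. a' + x *\<^sub>R (a - a')" and ?z = "\<lambda>x. b' + x *\<^sub>R (b - b')"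
    let ?l = "(b - a) - (b' - a')" and ?H = "norm (b - a) + norm (b' - a')"
    let ?\<phi> = "\<lambda>x. g (?z x) - g (?y x)"
    have "\<bar>?\<phi> 1 - ?\<phi> 0\<bar> \<le> K0 * norm ?l + K1 * ?H * norm (a - a')"
    proof (rule increment_le_derivative_bound)
      fix x :: real assume x: "0 \<le> x" "x \<le> 1"
      show "(?\<phi> has_real_derivative grad g (?z x) \<bullet> (b - b') - grad g (?y x) \<bullet> (a - a')) (at x)"
        by (intro DERIV_diff has_real_derivative_line smooth_on_differentiable[OF g]) auto
      have yz: "?y x \<in> B" "?z x \<in> B"
        using segment_in_convex[OF B(2) _ _ x] ab by blast+
      have "?z x - ?y x = (b' - a') + x *\<^sub>R ((b - a) - (b' - a'))" by (simp add: algebra_simps)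
      then have "norm (?z x - ?y x) \<le> ?H" using norm_convex_combination_le[OF x] by metis
      then have "norm (grad g (?z x) - grad g (?y x)) \<le> K1 * ?H"
        using K1(2)[OF yz] K1(1) by (meson mult_left_mono order_trans)
      then have 1: "\<bar>(grad g (?z x) - grad g (?y x)) \<bullet> (a - a')\<bar> \<le> K1 * ?H * norm (a - a')"
        by (meson Cauchy_Schwarz_ineq2 mult_right_mono norm_ge_zero order_trans)
      have 2: "\<bar>grad g (?z x) \<bullet> ?l\<bar> \<le> K0 * norm ?l"
        using K0(2)[OF yz(2)] by (meson Cauchy_Schwarz_ineq2 mult_right_mono norm_ge_zero order_trans)
      have "grad g (?z x) \<bullet> (b - b') - grad g (?y x) \<bullet> (a - a')
        = grad g (?z x) \<bullet> ?l + (grad g (?z x) - grad g (?y x)) \<bullet> (a - a')"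
        by (simp add: inner_diff_left inner_diff_right)
      then show "\<bar>grad g (?z x) \<bullet> (b - b') - grad g (?y x) \<bullet> (a - a')\<bar>
        \<le> K0 * norm ?l + K1 * ?H * norm (a - a')" using 1 2 by linarith
    qed
    also have "\<dots> \<le> (K0 + K1) * norm ?l + (K0 + K1) * (norm (a - a') * ?H)"
    proof -
      have "0 \<le> K1 * norm ?l" "0 \<le> K0 * (norm (a - a') * ?H)"
        using K0(1) K1(1) by simp_all
      then show ?thesis by (simp add: algebra_simps)
    qed
    finally show "\<bar>(g b - g a) - (g b' - g a')\<bar> \<le> (K0 + K1) * (norm ?l + norm (a - a') * ?H)"
      by (simp add: algebra_simps)
  qed
qed

text \<open>The same homotopy, now differentiating the Taylor remainder of g. Its derivative is
  (grad g(z) - grad g(y)) applied to the difference of the increments, plus the Taylor remainders of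
  the partial derivatives of g paired with a - a'. The former is a product of two small factors, the
  latter is quadratic in the increments.\<close>

lemma taylor_rem_difference_bound:
  fixes g :: "real^'m::finite \<Rightarrow> real"
  assumes g: "smooth_on UNIV g" and B: "compact B" "convex B"
  obtains K where "0 \<le> K" "\<And>a b a' b'. a \<in> B \<Longrightarrow> b \<in> B \<Longrightarrow> a' \<in> B \<Longrightarrow> b' \<in> B \<Longrightarrow>
    \<bar>taylor_rem g a b - taylor_rem g a' b'\<bar>
      \<le> K * (norm ((b - a) - (b' - a')) * (norm (b - a) + norm (b' - a'))
          + norm (a - a') * (norm (b - a) + norm (b' - a'))\<^sup>2)"
proof -
  obtain K1 where K1: "0 \<le> K1" "\<And>a b. a \<in> B \<Longrightarrow> b \<in> B \<Longrightarrow> norm (grad g b - grad g a) \<le> K1 * norm (b - a)"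
    using grad_lipschitz[OF g B] by blast
  have "\<exists>K. 0 \<le> K \<and> (\<forall>a\<in>B. \<forall>b\<in>B. \<bar>taylor_rem (partial j g) a b\<bar> \<le> K * (norm (b - a))\<^sup>2)" for j
    using taylor_rem_bound[OF smooth_on_partial[OF g] B, of j] by metis
  then obtain K where K: "\<And>j. 0 \<le> K j"
    "\<And>j a b. a \<in> B \<Longrightarrow> b \<in> B \<Longrightarrow> \<bar>taylor_rem (partial j g) a b\<bar> \<le> K j * (norm (b - a))\<^sup>2"
    by metis
  define K2 where "K2 = (\<Sum>j\<in>UNIV. K j)"
  have "0 \<le> K2" unfolding K2_def using K(1) by (simp add: sum_nonneg)
  show ?thesis
  proof (rule that[of "K1 + K2"])
    show "0 \<le> K1 + K2" using K1(1) \<open>0 \<le> K2\<close> by simp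
    fix a b a' b' assume ab: "a \<in> B" "b \<in> B" "a' \<in> B" "b' \<in> B"
    let ?y = "\<lambda>x. a' + x *\<^sub>R (a - a')" and ?z = "\<lambda>x. b' + x *\<^sub>R (b - b')"
    let ?h = "\<lambda>x. (b' - a') + x *\<^sub>R ((b - a) - (b' - a'))"
    let ?k = "a - a'" and ?l = "(b - a) - (b' - a')" and ?H = "norm (b - a) + norm (b' - a')"
    \<comment> \<open>The linear part of the remainder is written in coordinates because both its
      factors depend on x, so that the product rule is needed.\<close>
    let ?\<phi> = "\<lambda>x. g (?z x) - g (?y x) - (\<Sum>i\<in>UNIV. partial i g (?y x) * (?h x $ i))"
    have zy: "?z x - ?y x = ?h x" for x by (simp add: algebra_simps)
    have \<phi>: "?\<phi> x = taylor_rem g (?y x) (?z x)" for x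
      unfolding taylor_rem_def zy by (simp add: inner_vec_def)
    have "\<bar>?\<phi> 1 - ?\<phi> 0\<bar> \<le> K1 * ?H * norm ?l + K2 * (norm ?k * ?H\<^sup>2)"
    proof (rule increment_le_derivative_bound)
      fix x :: real assume x: "0 \<le> x" "x \<le> 1"
      let ?D = "grad g (?z x) \<bullet> (b - b') - grad g (?y x) \<bullet> ?k
        - (\<Sum>i\<in>UNIV. (grad (partial i g) (?y x) \<bullet> ?k) * (?h x $ i) + ?l $ i * partial i g (?y x))"
      have "((\<lambda>x. ?h x $ i) has_real_derivative ?l $ i) (at x)" for i
        by (auto intro!: derivative_eq_intros)
      then show "(?\<phi> has_real_derivative ?D) (at x)"
        by (intro DERIV_diff DERIV_sum DERIV_mult has_real_derivative_line
            smooth_on_differentiable[OF g] smooth_on_differentiable[OF smooth_on_partial[OF g]]) auto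
      have yz: "?y x \<in> B" "?z x \<in> B"
        using segment_in_convex[OF B(2) _ _ x] ab by blast+
      have h: "norm (?h x) \<le> ?H" by (rule norm_convex_combination_le[OF x])
      have "norm (grad g (?z x) - grad g (?y x)) \<le> K1 * norm (?h x)"
        using K1(2)[OF yz] by (simp only: zy)
      also have "\<dots> \<le> K1 * ?H" using h K1(1) by (rule mult_left_mono)
      finally have 1: "\<bar>(grad g (?z x) - grad g (?y x)) \<bullet> ?l\<bar> \<le> K1 * ?H * norm ?l"
        by (meson Cauchy_Schwarz_ineq2 mult_right_mono norm_ge_zero order_trans)
      have "(\<Sum>i\<in>UNIV. (grad (partial i g) (?y x) \<bullet> ?k) * (?h x $ i))
          = (\<Sum>i\<in>UNIV. \<Sum>j\<in>UNIV. partial j (partial i g) (?y x) * ?k $ j * (?h x $ i))"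
        by (simp add: inner_vec_def sum_distrib_right)
      also have "\<dots> = (\<Sum>j\<in>UNIV. \<Sum>i\<in>UNIV. partial j (partial i g) (?y x) * ?k $ j * (?h x $ i))"
        by (rule sum.swap)
      \<comment> \<open>Symmetry of the Hessian moves the outer derivative from the direction a - a'
        to the increment \<open>?h x\<close>; only then do the terms assemble into first-order
        Taylor remainders of the \<open>partial j g\<close>.\<close>
      also have "\<dots> = (\<Sum>j\<in>UNIV. \<Sum>i\<in>UNIV. ?k $ j * (partial i (partial j g) (?y x) * (?h x $ i)))"
        by (intro sum.cong refl) (simp add: partial_commute[OF open_UNIV UNIV_I g] mult_ac)
      also have "\<dots> = (\<Sum>j\<in>UNIV. ?k $ j * (grad (partial j g) (?y x) \<bullet> ?h x))"
        by (simp add: inner_vec_def sum_distrib_left)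
      finally have "?D = (grad g (?z x) - grad g (?y x)) \<bullet> ?l
          + (grad g (?z x) - grad g (?y x)) \<bullet> ?k - (\<Sum>j\<in>UNIV. ?k $ j * (grad (partial j g) (?y x) \<bullet> ?h x))"
        by (simp add: sum.distrib inner_diff_left inner_diff_right)
          (simp add: inner_vec_def algebra_simps sum_subtractf sum.distrib)
      also have "(grad g (?z x) - grad g (?y x)) \<bullet> ?k
          = (\<Sum>j\<in>UNIV. ?k $ j * (partial j g (?z x) - partial j g (?y x)))"
        by (simp add: inner_vec_def mult.commute)
      finally have D: "?D = (grad g (?z x) - grad g (?y x)) \<bullet> ?l
          + (\<Sum>j\<in>UNIV. ?k $ j * taylor_rem (partial j g) (?y x) (?z x))"
        unfolding taylor_rem_def zy by (simp add: right_diff_distrib sum_subtractf)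
      have "\<bar>\<Sum>j\<in>UNIV. ?k $ j * taylor_rem (partial j g) (?y x) (?z x)\<bar>
          \<le> (\<Sum>j\<in>UNIV. \<bar>?k $ j * taylor_rem (partial j g) (?y x) (?z x)\<bar>)"
        by (rule sum_abs)
      also have "\<dots> \<le> (\<Sum>j\<in>UNIV. norm ?k * (K j * ?H\<^sup>2))"
      proof (rule sum_mono)
        fix j
        have "\<bar>taylor_rem (partial j g) (?y x) (?z x)\<bar> \<le> K j * (norm (?h x))\<^sup>2"
          using K(2)[OF yz] by (simp only: zy)
        also have "\<dots> \<le> K j * ?H\<^sup>2"
          using h K(1) by (intro mult_left_mono power_mono) auto
        finally show "\<bar>?k $ j * taylor_rem (partial j g) (?y x) (?z x)\<bar> \<le> norm ?k * (K j * ?H\<^sup>2)"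
          unfolding abs_mult by (intro mult_mono component_le_norm_cart) auto
      qed
      also have "\<dots> = K2 * (norm ?k * ?H\<^sup>2)"
        by (simp add: K2_def sum_distrib_left sum_distrib_right mult_ac)
      finally show "\<bar>?D\<bar> \<le> K1 * ?H * norm ?l + K2 * (norm ?k * ?H\<^sup>2)"
        using 1 D by linarith
    qed
    also have "\<dots> \<le> (K1 + K2) * (norm ?l * ?H) + (K1 + K2) * (norm ?k * ?H\<^sup>2)"
    proof -
      have "0 \<le> K2 * (norm ?l * ?H)" "0 \<le> K1 * (norm ?k * ?H\<^sup>2)"
        using \<open>0 \<le> K2\<close> K1(1) by simp_all
      then show ?thesis by (simp add: algebra_simps)
    qed
    finally show "\<bar>taylor_rem g a b - taylor_rem g a' b'\<bar> \<le> (K1 + K2) * (norm ?l * ?H + norm ?k * ?H\<^sup>2)"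
      unfolding \<phi> by (simp add: distrib_left)
  qed
qed


section \<open>Local expansions along two curves\<close>

text \<open>Membership in \<open>O[principal \<Delta>](g)\<close> means a bound by a constant multiple of \<open>g\<close> on all of
  \<open>\<Delta>\<close>; the Landau calculus then keeps track of the constants.\<close>

lemma bigo_principalI:
  fixes f g :: "'x \<Rightarrow> real"
  assumes "\<And>\<xi>. \<xi> \<in> \<Delta> \<Longrightarrow> \<bar>f \<xi>\<bar> \<le> K * \<bar>g \<xi>\<bar>"
  shows "f \<in> O[principal \<Delta>](g)"
  by (rule bigoI[of _ K]) (simp add: eventually_principal assms)

lemma bigo_principal_add:
  fixes f f' g g' h :: "'x \<Rightarrow> real"
  assumes "f \<in> O[principal \<Delta>](g)" "f' \<in> O[principal \<Delta>](g')"
    and "\<And>\<xi>. \<xi> \<in> \<Delta> \<Longrightarrow> \<bar>g \<xi>\<bar> \<le> h \<xi>" "\<And>\<xi>. \<xi> \<in> \<Delta> \<Longrightarrow> \<bar>g' \<xi>\<bar> \<le> h \<xi>"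
  shows "(\<lambda>\<xi>. f \<xi> + f' \<xi>) \<in> O[principal \<Delta>](h)"
proof (rule sum_in_bigo)
  have "\<bar>g \<xi>\<bar> \<le> 1 * \<bar>h \<xi>\<bar>" "\<bar>g' \<xi>\<bar> \<le> 1 * \<bar>h \<xi>\<bar>" if "\<xi> \<in> \<Delta>" for \<xi>
    using assms(3,4)[OF that] by linarith+
  then have "g \<in> O[principal \<Delta>](h)" "g' \<in> O[principal \<Delta>](h)"
    using bigo_principalI by blast+
  then show "f \<in> O[principal \<Delta>](h)" "f' \<in> O[principal \<Delta>](h)"
    using assms(1,2) landau_o.big_trans by blast+
qed

lemma smooth_bigo_const:
  fixes g :: "real^'m::finite \<Rightarrow> real"
  assumes "smooth_on UNIV g" "compact B" "\<And>\<xi>. \<xi> \<in> \<Delta> \<Longrightarrow> a \<xi> \<in> B"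
  shows "(\<lambda>\<xi>. g (a \<xi>)) \<in> O[principal \<Delta>](\<lambda>_. 1)"
proof -
  obtain K where "\<And>p. p \<in> B \<Longrightarrow> \<bar>g p\<bar> \<le> K" using smooth_bounded[OF assms(1,2)] by blast
  then show ?thesis using assms(3) by (intro bigo_principalI[of _ _ K]) simp
qed

lemma smooth_diff_bigo:
  fixes g :: "real^'m::finite \<Rightarrow> real"
  assumes "smooth_on UNIV g" "compact B" "convex B"
    and "\<And>\<xi>. \<xi> \<in> \<Delta> \<Longrightarrow> a \<xi> \<in> B" "\<And>\<xi>. \<xi> \<in> \<Delta> \<Longrightarrow> a' \<xi> \<in> B"
  shows "(\<lambda>\<xi>. g (a \<xi>) - g (a' \<xi>)) \<in> O[principal \<Delta>](\<lambda>\<xi>. norm (a \<xi> - a' \<xi>))"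
proof -
  obtain K where "\<And>p q. p \<in> B \<Longrightarrow> q \<in> B \<Longrightarrow> \<bar>g q - g p\<bar> \<le> K * norm (q - p)"
    using smooth_lipschitz[OF assms(1-3)] by blast
  then show ?thesis using assms(4,5) by (intro bigo_principalI[of _ _ K]) simp
qed

lemma norm_bigo:
  fixes v :: "'x \<Rightarrow> real^'m::finite"
  assumes "\<And>j. (\<lambda>\<xi>. v \<xi> $ j) \<in> O[F](g)"
  shows "(\<lambda>\<xi>. norm (v \<xi>)) \<in> O[F](g)"
proof -
  have "(\<lambda>\<xi>. \<Sum>j\<in>UNIV. \<bar>v \<xi> $ j\<bar>) \<in> O[F](g)"
    using assms by (intro big_sum_in_bigo) simp
  moreover have "(\<lambda>\<xi>. norm (v \<xi>)) \<in> O[F](\<lambda>\<xi>. \<Sum>j\<in>UNIV. \<bar>v \<xi> $ j\<bar>)"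
    by (rule landau_o.big_mono) (simp add: norm_le_l1_cart sum_nonneg)
  ultimately show ?thesis using landau_o.big_trans by blast
qed

text \<open>The part of the local expansion that is linear in the first-level increments:
  \<open>c\<close> stands for the field coefficients at a point, \<open>x\<close> for the increments
  of X at single vertices.\<close>

definition germ1 :: "('n::finite forest \<Rightarrow> real) \<Rightarrow> ('n \<Rightarrow> real) \<Rightarrow> real" where
  "germ1 c x = (\<Sum>\<alpha>\<in>UNIV. c (Vertex \<alpha>) * x \<alpha>)"

text \<open>The part of order \<omega>^(2/p). The component of X at \<alpha>\<cdot>\<beta> is
  replaced by a product of first-level increments, and the half compensates for summing over ordered
  pairs.\<close>

definition germ2 :: "('n::finite forest \<Rightarrow> real) \<Rightarrow> ('n \<Rightarrow> real) \<Rightarrow> ('n \<Rightarrow> 'n \<Rightarrow> real) \<Rightarrow> real" where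
  "germ2 c x l = (\<Sum>\<alpha>\<in>UNIV. \<Sum>\<beta>\<in>UNIV. c (\<alpha> \<cdot>\<^sub>F \<beta>) * (x \<alpha> * x \<beta>)) / 2
    + (\<Sum>\<alpha>\<in>UNIV. \<Sum>\<beta>\<in>UNIV. c (Ladder \<alpha> \<beta>) * l \<alpha> \<beta>)"

lemma germ1_diff: "germ1 c x - germ1 c' x = germ1 (\<lambda>\<tau>. c \<tau> - c' \<tau>) x"
  by (simp add: germ1_def sum_subtractf left_diff_distrib)

lemma germ2_diff: "germ2 c x l - germ2 c' x l = germ2 (\<lambda>\<tau>. c \<tau> - c' \<tau>) x l"
  by (simp add: germ2_def sum_subtractf left_diff_distrib diff_divide_distrib)

lemma germ1_bigo:
  assumes "\<And>\<tau>. (\<lambda>\<xi>. c \<xi> \<tau>) \<in> O[F](f)" "\<And>\<alpha>. (\<lambda>\<xi>. x \<xi> \<alpha>) \<in> O[F](w)"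
  shows "(\<lambda>\<xi>. germ1 (c \<xi>) (x \<xi>)) \<in> O[F](\<lambda>\<xi>. f \<xi> * w \<xi>)"
  unfolding germ1_def using assms by (intro big_sum_in_bigo landau_o.big.mult)

lemma germ2_bigo:
  assumes c: "\<And>\<tau>. (\<lambda>\<xi>. c \<xi> \<tau>) \<in> O[F](f)" and x: "\<And>\<alpha>. (\<lambda>\<xi>. x \<xi> \<alpha>) \<in> O[F](w)"
    and l: "\<And>\<alpha> \<beta>. (\<lambda>\<xi>. l \<xi> \<alpha> \<beta>) \<in> O[F](\<lambda>\<xi>. w \<xi> * w \<xi>)"
  shows "(\<lambda>\<xi>. germ2 (c \<xi>) (x \<xi>) (l \<xi>)) \<in> O[F](\<lambda>\<xi>. f \<xi> * (w \<xi> * w \<xi>))"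
  unfolding germ2_def
proof (rule sum_in_bigo)
  have "(\<lambda>\<xi>. \<Sum>\<alpha>\<in>UNIV. \<Sum>\<beta>\<in>UNIV. c \<xi> (\<alpha> \<cdot>\<^sub>F \<beta>) * (x \<xi> \<alpha> * x \<xi> \<beta>))
      \<in> O[F](\<lambda>\<xi>. f \<xi> * (w \<xi> * w \<xi>))"
    by (intro big_sum_in_bigo landau_o.big.mult c x)
  then show "(\<lambda>\<xi>. (\<Sum>\<alpha>\<in>UNIV. \<Sum>\<beta>\<in>UNIV. c \<xi> (\<alpha> \<cdot>\<^sub>F \<beta>) * (x \<xi> \<alpha> * x \<xi> \<beta>)) / 2)
      \<in> O[F](\<lambda>\<xi>. f \<xi> * (w \<xi> * w \<xi>))" by simp
  show "(\<lambda>\<xi>. \<Sum>\<alpha>\<in>UNIV. \<Sum>\<beta>\<in>UNIV. c \<xi> (Ladder \<alpha> \<beta>) * l \<xi> \<alpha> \<beta>)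
      \<in> O[F](\<lambda>\<xi>. f \<xi> * (w \<xi> * w \<xi>))"
    by (intro big_sum_in_bigo landau_o.big.mult c l)
qed

text \<open>In the application the index is a triple \<open>s \<le> u \<le> t\<close>, \<open>w\<close> is \<open>\<omega>(s,t)\<^bsup>1/p\<^esup>\<close>, \<open>a\<close> and \<open>b\<close> are the
  values of a curve at \<open>s\<close> and \<open>u\<close>, the increments of \<open>X\<close> over \<open>[s,u]\<close> are \<open>x\<close>, \<open>k\<close> and those over
  \<open>[u,t]\<close> are \<open>y\<close>, \<open>l\<close>.  Admissibility cancels the terms of second order in \<open>D\<close>, which gains the
  third factor \<open>w\<close>.\<close>

lemma germ_defect_difference_bigo:
  fixes F :: "'m::finite \<Rightarrow> 'n::finite forest \<Rightarrow> real^'m \<Rightarrow> real"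
    and a b a' b' :: "'x \<Rightarrow> real^'m"
    and x y :: "'x \<Rightarrow> 'n \<Rightarrow> real" and k l :: "'x \<Rightarrow> 'n \<Rightarrow> 'n \<Rightarrow> real"
    and w d :: "'x \<Rightarrow> real"
  assumes F: "\<And>i \<tau>. smooth_on UNIV (F i \<tau>)"
    and adm: "\<And>i \<alpha> \<beta> p. (\<Sum>j\<in>UNIV. partial j (F i (Vertex \<beta>)) p * F j (Vertex \<alpha>) p)
      = F i (\<alpha> \<cdot>\<^sub>F \<beta>) p + F i (Ladder \<alpha> \<beta>) p"
    and B: "compact B" "convex B"
    and inB: "\<And>\<xi>. \<xi> \<in> \<Delta> \<Longrightarrow> a \<xi> \<in> B" "\<And>\<xi>. \<xi> \<in> \<Delta> \<Longrightarrow> b \<xi> \<in> B"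
      "\<And>\<xi>. \<xi> \<in> \<Delta> \<Longrightarrow> a' \<xi> \<in> B" "\<And>\<xi>. \<xi> \<in> \<Delta> \<Longrightarrow> b' \<xi> \<in> B"
    and w: "\<And>\<xi>. \<xi> \<in> \<Delta> \<Longrightarrow> 0 \<le> w \<xi>" "\<And>\<xi>. \<xi> \<in> \<Delta> \<Longrightarrow> w \<xi> \<le> 1" and d: "\<And>\<xi>. \<xi> \<in> \<Delta> \<Longrightarrow> 0 \<le> d \<xi>"
    and x: "\<And>\<alpha>. (\<lambda>\<xi>. x \<xi> \<alpha>) \<in> O[principal \<Delta>](w)" and y: "\<And>\<alpha>. (\<lambda>\<xi>. y \<xi> \<alpha>) \<in> O[principal \<Delta>](w)"
    and k: "\<And>\<alpha> \<beta>. (\<lambda>\<xi>. k \<xi> \<alpha> \<beta>) \<in> O[principal \<Delta>](\<lambda>\<xi>. w \<xi> * w \<xi>)"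
    and l: "\<And>\<alpha> \<beta>. (\<lambda>\<xi>. l \<xi> \<alpha> \<beta>) \<in> O[principal \<Delta>](\<lambda>\<xi>. w \<xi> * w \<xi>)"
  defines "r \<equiv> \<lambda>a b \<xi> i. b \<xi> $ i - a \<xi> $ i - germ1 (\<lambda>\<tau>. F i \<tau> (a \<xi>)) (x \<xi>) - germ2 (\<lambda>\<tau>. F i \<tau> (a \<xi>)) (x \<xi>) (k \<xi>)"
    and "D \<equiv> \<lambda>a b \<xi> i. germ1 (\<lambda>\<tau>. F i \<tau> (b \<xi>) - F i \<tau> (a \<xi>)) (y \<xi>) + germ2 (\<lambda>\<tau>. F i \<tau> (b \<xi>) - F i \<tau> (a \<xi>)) (y \<xi>) (l \<xi>)
        - (\<Sum>\<alpha>\<in>UNIV. \<Sum>\<beta>\<in>UNIV. (F i (\<alpha> \<cdot>\<^sub>F \<beta>) (a \<xi>) + F i (Ladder \<alpha> \<beta>) (a \<xi>)) * (x \<xi> \<alpha> * y \<xi> \<beta>))"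
  assumes r: "\<And>i. (\<lambda>\<xi>. r a b \<xi> i) \<in> O[principal \<Delta>](\<lambda>\<xi>. w \<xi> * w \<xi>)"
      "\<And>i. (\<lambda>\<xi>. r a' b' \<xi> i) \<in> O[principal \<Delta>](\<lambda>\<xi>. w \<xi> * w \<xi>)"
      "\<And>i. (\<lambda>\<xi>. r a b \<xi> i - r a' b' \<xi> i) \<in> O[principal \<Delta>](d)"
  shows "(\<lambda>\<xi>. D a b \<xi> i - D a' b' \<xi> i)
    \<in> O[principal \<Delta>](\<lambda>\<xi>. norm (a \<xi> - a' \<xi>) * (w \<xi> * w \<xi> * w \<xi>) + d \<xi> * w \<xi>)"
proof -
  let ?O = "\<lambda>g. O[principal \<Delta>](g)"
  let ?z = "\<lambda>\<xi>. norm (a \<xi> - a' \<xi>)" and ?w2 = "\<lambda>\<xi>. w \<xi> * w \<xi>"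
  \<comment> \<open>As \<open>w\<close> is at most 1, spare factors of \<open>w\<close> may be
    dropped; this keeps the number of different bounds small.\<close>
  have ww: "0 \<le> w \<xi> * w \<xi>" "w \<xi> * w \<xi> \<le> w \<xi>" if "\<xi> \<in> \<Delta>" for \<xi>
    using w[OF that] by (auto intro: mult_left_le)
  have zww: "?z \<xi> * (w \<xi> * w \<xi>) \<le> ?z \<xi> * w \<xi>" "0 \<le> ?z \<xi> * (w \<xi> * w \<xi>)" "0 \<le> ?z \<xi> * w \<xi>" if "\<xi> \<in> \<Delta>" for \<xi>
    using ww[OF that] w[OF that] by (auto intro!: mult_left_mono mult_nonneg_nonneg)
  have dw: "0 \<le> d \<xi> * w \<xi>" "d \<xi> * w \<xi> \<le> d \<xi>" if "\<xi> \<in> \<Delta>" for \<xi>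
    using d[OF that] w[OF that] by (auto intro: mult_left_le)
  have Fbd: "(\<lambda>\<xi>. F i \<tau> (c \<xi>)) \<in> ?O (\<lambda>_. 1)" if "\<And>\<xi>. \<xi> \<in> \<Delta> \<Longrightarrow> c \<xi> \<in> B" for i \<tau> c
    using smooth_bigo_const[OF F B(1) that] .
  have Fdiff: "(\<lambda>\<xi>. F i \<tau> (a \<xi>) - F i \<tau> (a' \<xi>)) \<in> ?O ?z" for i \<tau>
    using smooth_diff_bigo[OF F B inB(1,3)] .
  \<comment> \<open>The increment of the curve without its first-order part. It is O(w^2) for each
    curve, and its difference for the two curves inherits the bound \<open>d\<close> from the
    remainders \<open>r\<close>.\<close>
  define h2 where "h2 a b \<xi> = (b \<xi> - a \<xi>) - (\<chi> i. germ1 (\<lambda>\<tau>. F i \<tau> (a \<xi>)) (x \<xi>))" for a b \<xi>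
  have h2_eq: "h2 a b \<xi> $ i = r a b \<xi> i + germ2 (\<lambda>\<tau>. F i \<tau> (a \<xi>)) (x \<xi>) (k \<xi>)" for a b \<xi> i
    by (simp add: h2_def r_def)
  have h2: "(\<lambda>\<xi>. h2 a b \<xi> $ i) \<in> ?O ?w2" "(\<lambda>\<xi>. h2 a' b' \<xi> $ i) \<in> ?O ?w2" for i
  proof -
    have "(\<lambda>\<xi>. germ2 (\<lambda>\<tau>. F i \<tau> (c \<xi>)) (x \<xi>) (k \<xi>)) \<in> ?O (\<lambda>\<xi>. 1 * ?w2 \<xi>)"
      if "\<And>\<xi>. \<xi> \<in> \<Delta> \<Longrightarrow> c \<xi> \<in> B" for c
      using Fbd[OF that] x k by (rule germ2_bigo)
    from this[of a] this[of a'] inB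
    show "(\<lambda>\<xi>. h2 a b \<xi> $ i) \<in> ?O ?w2" "(\<lambda>\<xi>. h2 a' b' \<xi> $ i) \<in> ?O ?w2"
      unfolding h2_eq by (simp_all add: sum_in_bigo r)
  qed
  have h2_diff: "(\<lambda>\<xi>. h2 a b \<xi> $ i - h2 a' b' \<xi> $ i) \<in> ?O (\<lambda>\<xi>. ?z \<xi> * ?w2 \<xi> + d \<xi>)" for i
  proof -
    have "(\<lambda>\<xi>. (r a b \<xi> i - r a' b' \<xi> i) +
        germ2 (\<lambda>\<tau>. F i \<tau> (a \<xi>) - F i \<tau> (a' \<xi>)) (x \<xi>) (k \<xi>)) \<in> ?O (\<lambda>\<xi>. ?z \<xi> * ?w2 \<xi> + d \<xi>)"
      using d zww by (intro bigo_principal_add[OF r(3) germ2_bigo[OF Fdiff x k]]) fastforce+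
    then show ?thesis unfolding h2_eq germ2_diff[symmetric] by (simp add: algebra_simps)
  qed
  have h_eq: "(b \<xi> - a \<xi>) $ i = h2 a b \<xi> $ i + germ1 (\<lambda>\<tau>. F i \<tau> (a \<xi>)) (x \<xi>)" for a b \<xi> i
    by (simp add: h2_def)
  have h: "(\<lambda>\<xi>. norm (b \<xi> - a \<xi>)) \<in> ?O w" "(\<lambda>\<xi>. norm (b' \<xi> - a' \<xi>)) \<in> ?O w"
  proof -
    have "(\<lambda>\<xi>. germ1 (\<lambda>\<tau>. F i \<tau> (c \<xi>)) (x \<xi>)) \<in> ?O (\<lambda>\<xi>. 1 * w \<xi>)"
      if "\<And>\<xi>. \<xi> \<in> \<Delta> \<Longrightarrow> c \<xi> \<in> B" for i c
      using Fbd[OF that] x by (rule germ1_bigo)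
    from this[of a] this[of a'] inB
    have germ1_w: "(\<lambda>\<xi>. germ1 (\<lambda>\<tau>. F i \<tau> (a \<xi>)) (x \<xi>)) \<in> ?O w"
      "(\<lambda>\<xi>. germ1 (\<lambda>\<tau>. F i \<tau> (a' \<xi>)) (x \<xi>)) \<in> ?O w" for i by simp_all
    have "?w2 \<in> ?O w"
      by (rule bigo_principalI[of _ _ 1]) (simp add: ww w)
    then have h2_w: "(\<lambda>\<xi>. h2 a b \<xi> $ i) \<in> ?O w" "(\<lambda>\<xi>. h2 a' b' \<xi> $ i) \<in> ?O w" for i
      using h2 landau_o.big_trans by blast+
    show "(\<lambda>\<xi>. norm (b \<xi> - a \<xi>)) \<in> ?O w"
      by (rule norm_bigo, unfold h_eq, rule sum_in_bigo[OF h2_w(1) germ1_w(1)])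
    show "(\<lambda>\<xi>. norm (b' \<xi> - a' \<xi>)) \<in> ?O w"
      by (rule norm_bigo, unfold h_eq, rule sum_in_bigo[OF h2_w(2) germ1_w(2)])
  qed
  have l': "(\<lambda>\<xi>. norm ((b \<xi> - a \<xi>) - (b' \<xi> - a' \<xi>))) \<in> ?O (\<lambda>\<xi>. ?z \<xi> * w \<xi> + d \<xi>)"
  proof (rule norm_bigo)
    fix i
    have "(\<lambda>\<xi>. (h2 a b \<xi> $ i - h2 a' b' \<xi> $ i) + germ1 (\<lambda>\<tau>. F i \<tau> (a \<xi>) - F i \<tau> (a' \<xi>)) (x \<xi>))
        \<in> ?O (\<lambda>\<xi>. ?z \<xi> * w \<xi> + d \<xi>)"
      using d zww by (intro bigo_principal_add[OF h2_diff germ1_bigo[OF Fdiff x]]) fastforce+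
    then show "(\<lambda>\<xi>. ((b \<xi> - a \<xi>) - (b' \<xi> - a' \<xi>)) $ i) \<in> ?O (\<lambda>\<xi>. ?z \<xi> * w \<xi> + d \<xi>)"
      unfolding vector_minus_component[of "b _ - a _"] h_eq germ1_diff[symmetric] by (simp add: algebra_simps)
  qed
  have zh: "(\<lambda>\<xi>. ?z \<xi> * (norm (b \<xi> - a \<xi>) + norm (b' \<xi> - a' \<xi>))) \<in> ?O (\<lambda>\<xi>. ?z \<xi> * w \<xi>)"
    by (intro landau_o.big.mult sum_in_bigo h landau_o.big_refl)
  have Fdd: "(\<lambda>\<xi>. (F i \<tau> (b \<xi>) - F i \<tau> (a \<xi>)) - (F i \<tau> (b' \<xi>) - F i \<tau> (a' \<xi>))) \<in> ?O (\<lambda>\<xi>. ?z \<xi> * w \<xi> + d \<xi>)" for i \<tau>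
  proof -
    obtain K where K: "\<And>a b a' b'. a \<in> B \<Longrightarrow> b \<in> B \<Longrightarrow> a' \<in> B \<Longrightarrow> b' \<in> B \<Longrightarrow>
      \<bar>(F i \<tau> b - F i \<tau> a) - (F i \<tau> b' - F i \<tau> a')\<bar>
        \<le> K * (norm ((b - a) - (b' - a')) + norm (a - a') * (norm (b - a) + norm (b' - a')))"
      using increment_difference_bound[OF F B] by metis
    have "(\<lambda>\<xi>. (F i \<tau> (b \<xi>) - F i \<tau> (a \<xi>)) - (F i \<tau> (b' \<xi>) - F i \<tau> (a' \<xi>))) \<in>
      ?O (\<lambda>\<xi>. norm ((b \<xi> - a \<xi>) - (b' \<xi> - a' \<xi>)) + ?z \<xi> * (norm (b \<xi> - a \<xi>) + norm (b' \<xi> - a' \<xi>)))"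
      using K inB by (intro bigo_principalI[of _ _ K]) (simp add: abs_of_nonneg)
    moreover have "(\<lambda>\<xi>. norm ((b \<xi> - a \<xi>) - (b' \<xi> - a' \<xi>)) + ?z \<xi> * (norm (b \<xi> - a \<xi>) + norm (b' \<xi> - a' \<xi>)))
      \<in> ?O (\<lambda>\<xi>. ?z \<xi> * w \<xi> + d \<xi>)"
      using d zww by (intro bigo_principal_add[OF l' zh]) fastforce+
    ultimately show ?thesis using landau_o.big_trans by blast
  qed
  have Q: "(\<lambda>\<xi>. taylor_rem (F i \<tau>) (a \<xi>) (b \<xi>) - taylor_rem (F i \<tau>) (a' \<xi>) (b' \<xi>)) \<in>
     ?O (\<lambda>\<xi>. ?z \<xi> * ?w2 \<xi> + d \<xi>)" for i \<tau>
  proof -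
    obtain K where K: "\<And>a b a' b'. a \<in> B \<Longrightarrow> b \<in> B \<Longrightarrow> a' \<in> B \<Longrightarrow> b' \<in> B \<Longrightarrow>
      \<bar>taylor_rem (F i \<tau>) a b - taylor_rem (F i \<tau>) a' b'\<bar>
      \<le> K * (norm ((b - a) - (b' - a')) * (norm (b - a) + norm (b' - a'))
          + norm (a - a') * (norm (b - a) + norm (b' - a'))\<^sup>2)"
      using taylor_rem_difference_bound[OF F B] by metis
    let ?H = "\<lambda>\<xi>. norm (b \<xi> - a \<xi>) + norm (b' \<xi> - a' \<xi>)"
    have "(\<lambda>\<xi>. taylor_rem (F i \<tau>) (a \<xi>) (b \<xi>) - taylor_rem (F i \<tau>) (a' \<xi>) (b' \<xi>)) \<in>
      ?O (\<lambda>\<xi>. norm ((b \<xi> - a \<xi>) - (b' \<xi> - a' \<xi>)) * ?H \<xi> + ?z \<xi> * (?H \<xi>)\<^sup>2)"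
      using K inB by (intro bigo_principalI[of _ _ K]) (simp add: abs_of_nonneg)
    moreover have "(\<lambda>\<xi>. norm ((b \<xi> - a \<xi>) - (b' \<xi> - a' \<xi>)) * ?H \<xi> + ?z \<xi> * (?H \<xi>)\<^sup>2) \<in>
      ?O (\<lambda>\<xi>. ?z \<xi> * ?w2 \<xi> + d \<xi>)"
    proof (rule bigo_principal_add)
      have H: "?H \<in> ?O w" by (intro sum_in_bigo h)
      show "(\<lambda>\<xi>. norm ((b \<xi> - a \<xi>) - (b' \<xi> - a' \<xi>)) * ?H \<xi>) \<in> ?O (\<lambda>\<xi>. (?z \<xi> * w \<xi> + d \<xi>) * w \<xi>)"
        by (intro landau_o.big.mult l' H)
      show "(\<lambda>\<xi>. ?z \<xi> * (?H \<xi>)\<^sup>2) \<in> ?O (\<lambda>\<xi>. ?z \<xi> * ?w2 \<xi>)"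
        unfolding power2_eq_square by (intro landau_o.big.mult H landau_o.big_refl)
      show "\<bar>(?z \<xi> * w \<xi> + d \<xi>) * w \<xi>\<bar> \<le> ?z \<xi> * ?w2 \<xi> + d \<xi>" if "\<xi> \<in> \<Delta>" for \<xi>
        using dw[OF that] zww[OF that] by (simp add: distrib_right mult.assoc)
      show "\<bar>?z \<xi> * ?w2 \<xi>\<bar> \<le> ?z \<xi> * ?w2 \<xi> + d \<xi>" if "\<xi> \<in> \<Delta>" for \<xi>
        using d[OF that] zww[OF that] by simp
    qed
    ultimately show ?thesis using landau_o.big_trans by blast
  qed
  \<comment> \<open>What remains of the coefficient of \<open>y \<xi> \<beta>\<close> in
    \<open>D\<close> once admissibility has cancelled the linear response of F_\<beta> to the
    first-order part of the increment: a Taylor remainder, and the gradient applied to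
    \<open>h2\<close>.\<close>
  define G where "G i \<beta> a b \<xi> = taylor_rem (F i (Vertex \<beta>)) (a \<xi>) (b \<xi>) + grad (F i (Vertex \<beta>)) (a \<xi>) \<bullet> h2 a b \<xi>"
    for i \<beta> a b \<xi>
  have G_diff: "(\<lambda>\<xi>. G i \<beta> a b \<xi> - G i \<beta> a' b' \<xi>) \<in> ?O (\<lambda>\<xi>. ?z \<xi> * ?w2 \<xi> + d \<xi>)" for i \<beta>
  proof -
    let ?p = "\<lambda>j. partial j (F i (Vertex \<beta>))"
    have p: "smooth_on UNIV (?p j)" for j by (intro smooth_on_partial F)
    \<comment> \<open>A difference of products, split so that each summand contains exactly one
      difference between the two curves.\<close>
    have "(\<lambda>\<xi>. (?p j (a \<xi>) - ?p j (a' \<xi>)) * h2 a b \<xi> $ j + ?p j (a' \<xi>) * (h2 a b \<xi> $ j - h2 a' b' \<xi> $ j))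
        \<in> ?O (\<lambda>\<xi>. ?z \<xi> * ?w2 \<xi> + d \<xi>)" for j
      by (rule bigo_principal_add[OF landau_o.big.mult[OF smooth_diff_bigo[OF p B inB(1,3)] h2(1)]
            landau_o.big.mult[OF smooth_bigo_const[OF p B(1) inB(3)] h2_diff]])
         (use d zww in \<open>auto simp: abs_of_nonneg\<close>)
    then have "(\<lambda>\<xi>. \<Sum>j\<in>UNIV. (?p j (a \<xi>) - ?p j (a' \<xi>)) * h2 a b \<xi> $ j + ?p j (a' \<xi>) * (h2 a b \<xi> $ j - h2 a' b' \<xi> $ j))
        \<in> ?O (\<lambda>\<xi>. ?z \<xi> * ?w2 \<xi> + d \<xi>)"
      by (rule big_sum_in_bigo)
    from sum_in_bigo(1)[OF Q[of i "Vertex \<beta>"] this] show ?thesis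
      by (simp add: G_def inner_vec_def algebra_simps sum_subtractf)
  qed
  have D_eq: "D a b \<xi> i = (\<Sum>\<beta>\<in>UNIV. G i \<beta> a b \<xi> * y \<xi> \<beta>)
      + germ2 (\<lambda>\<tau>. F i \<tau> (b \<xi>) - F i \<tau> (a \<xi>)) (y \<xi>) (l \<xi>)" for a b \<xi>
  proof -
    \<comment> \<open>Admissibility enters here: the derivative of F_\<beta> along the first-order
      part of the increment produces the coefficients of the subtracted cross term.\<close>
    have "grad (F i (Vertex \<beta>)) (a \<xi>) \<bullet> (\<chi> j. germ1 (\<lambda>\<tau>. F j \<tau> (a \<xi>)) (x \<xi>))
        = (\<Sum>\<alpha>\<in>UNIV. (F i (\<alpha> \<cdot>\<^sub>F \<beta>) (a \<xi>) + F i (Ladder \<alpha> \<beta>) (a \<xi>)) * x \<xi> \<alpha>)" for \<beta>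
    proof -
      have "grad (F i (Vertex \<beta>)) (a \<xi>) \<bullet> (\<chi> j. germ1 (\<lambda>\<tau>. F j \<tau> (a \<xi>)) (x \<xi>))
        = (\<Sum>j\<in>UNIV. \<Sum>\<alpha>\<in>UNIV. partial j (F i (Vertex \<beta>)) (a \<xi>) * F j (Vertex \<alpha>) (a \<xi>) * x \<xi> \<alpha>)"
        by (simp add: inner_vec_def germ1_def sum_distrib_left mult.assoc)
      also have "\<dots> = (\<Sum>\<alpha>\<in>UNIV. \<Sum>j\<in>UNIV. partial j (F i (Vertex \<beta>)) (a \<xi>) * F j (Vertex \<alpha>) (a \<xi>) * x \<xi> \<alpha>)"
        by (rule sum.swap)
      finally show ?thesis by (simp add: sum_distrib_right[symmetric] adm)
    qed
    then have "G i \<beta> a b \<xi> = F i (Vertex \<beta>) (b \<xi>) - F i (Vertex \<beta>) (a \<xi>)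
        - (\<Sum>\<alpha>\<in>UNIV. (F i (\<alpha> \<cdot>\<^sub>F \<beta>) (a \<xi>) + F i (Ladder \<alpha> \<beta>) (a \<xi>)) * x \<xi> \<alpha>)" for \<beta>
      by (simp add: G_def taylor_rem_def h2_def inner_diff_right)
    then have "(\<Sum>\<beta>\<in>UNIV. G i \<beta> a b \<xi> * y \<xi> \<beta>) = germ1 (\<lambda>\<tau>. F i \<tau> (b \<xi>) - F i \<tau> (a \<xi>)) (y \<xi>)
        - (\<Sum>\<beta>\<in>UNIV. \<Sum>\<alpha>\<in>UNIV. (F i (\<alpha> \<cdot>\<^sub>F \<beta>) (a \<xi>) + F i (Ladder \<alpha> \<beta>) (a \<xi>)) * (x \<xi> \<alpha> * y \<xi> \<beta>))"
      by (simp add: germ1_def left_diff_distrib sum_subtractf sum_distrib_right mult.assoc)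
    also have "(\<Sum>\<beta>\<in>UNIV. \<Sum>\<alpha>\<in>UNIV. (F i (\<alpha> \<cdot>\<^sub>F \<beta>) (a \<xi>) + F i (Ladder \<alpha> \<beta>) (a \<xi>)) * (x \<xi> \<alpha> * y \<xi> \<beta>))
        = (\<Sum>\<alpha>\<in>UNIV. \<Sum>\<beta>\<in>UNIV. (F i (\<alpha> \<cdot>\<^sub>F \<beta>) (a \<xi>) + F i (Ladder \<alpha> \<beta>) (a \<xi>)) * (x \<xi> \<alpha> * y \<xi> \<beta>))"
      by (rule sum.swap)
    finally show ?thesis by (simp add: D_def)
  qed
  have "(\<lambda>\<xi>. (\<Sum>\<beta>\<in>UNIV. (G i \<beta> a b \<xi> - G i \<beta> a' b' \<xi>) * y \<xi> \<beta>)
      + germ2 (\<lambda>\<tau>. (F i \<tau> (b \<xi>) - F i \<tau> (a \<xi>)) - (F i \<tau> (b' \<xi>) - F i \<tau> (a' \<xi>))) (y \<xi>) (l \<xi>))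
    \<in> ?O (\<lambda>\<xi>. ?z \<xi> * (w \<xi> * w \<xi> * w \<xi>) + d \<xi> * w \<xi>)"
  \<comment> \<open>The first sum gains its factor \<open>w\<close> from \<open>y\<close>. The
    second carries w^2 already, so the weaker bound \<open>Fdd\<close> suffices there.\<close>
  proof (rule bigo_principal_add)
    show "(\<lambda>\<xi>. \<Sum>\<beta>\<in>UNIV. (G i \<beta> a b \<xi> - G i \<beta> a' b' \<xi>) * y \<xi> \<beta>)
        \<in> ?O (\<lambda>\<xi>. (?z \<xi> * ?w2 \<xi> + d \<xi>) * w \<xi>)"
      by (intro big_sum_in_bigo landau_o.big.mult G_diff y)
    show "(\<lambda>\<xi>. germ2 (\<lambda>\<tau>. (F i \<tau> (b \<xi>) - F i \<tau> (a \<xi>)) - (F i \<tau> (b' \<xi>) - F i \<tau> (a' \<xi>))) (y \<xi>) (l \<xi>))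
        \<in> ?O (\<lambda>\<xi>. (?z \<xi> * w \<xi> + d \<xi>) * ?w2 \<xi>)"
      by (intro germ2_bigo Fdd y l)
    fix \<xi> assume \<xi>: "\<xi> \<in> \<Delta>"
    have nn: "0 \<le> ?z \<xi> * (w \<xi> * w \<xi> * w \<xi>)" using w(1)[OF \<xi>] by simp
    then show "\<bar>(?z \<xi> * ?w2 \<xi> + d \<xi>) * w \<xi>\<bar> \<le> ?z \<xi> * (w \<xi> * w \<xi> * w \<xi>) + d \<xi> * w \<xi>"
      using dw(1)[OF \<xi>] by (simp add: distrib_right mult.assoc)
    have "d \<xi> * ?w2 \<xi> \<le> d \<xi> * w \<xi>" using ww(2)[OF \<xi>] d[OF \<xi>] by (rule mult_left_mono)
    moreover have "0 \<le> d \<xi> * ?w2 \<xi>" using ww(1)[OF \<xi>] d[OF \<xi>] by simp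
    ultimately show "\<bar>(?z \<xi> * w \<xi> + d \<xi>) * ?w2 \<xi>\<bar> \<le> ?z \<xi> * (w \<xi> * w \<xi> * w \<xi>) + d \<xi> * w \<xi>"
      using nn by (simp add: distrib_right mult.assoc)
  qed
  then show ?thesis
    unfolding D_eq germ2_diff[symmetric] by (simp add: left_diff_distrib sum_subtractf algebra_simps)
qed


section \<open>Sewing\<close>

lemma germ1_add: "germ1 c (\<lambda>\<alpha>. x \<alpha> + y \<alpha>) = germ1 c x + germ1 c y"
  by (simp add: germ1_def distrib_left sum.distrib)

text \<open>The product x_\<alpha> x_\<beta> of the summed increments has two mixed terms, which are
  equal after relabelling because \<alpha>\<cdot>\<beta> is unordered; together they cancel the
  half. The ladder adds its own mixed term from Chen's relation. The resulting coefficient is the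
  right-hand side of the admissibility condition.\<close>

lemma germ2_chen:
  fixes c :: "'n::finite forest \<Rightarrow> real"
  shows "germ2 c (\<lambda>\<alpha>. x \<alpha> + y \<alpha>) (\<lambda>\<alpha> \<beta>. k \<alpha> \<beta> + l \<alpha> \<beta> + x \<alpha> * y \<beta>) = germ2 c x k + germ2 c y l
    + (\<Sum>\<alpha>\<in>UNIV. \<Sum>\<beta>\<in>UNIV. (c (\<alpha> \<cdot>\<^sub>F \<beta>) + c (Ladder \<alpha> \<beta>)) * (x \<alpha> * y \<beta>))"
proof -
  have "(\<Sum>\<alpha>\<in>UNIV. \<Sum>\<beta>\<in>UNIV. c (\<alpha> \<cdot>\<^sub>F \<beta>) * (y \<alpha> * x \<beta>))
      = (\<Sum>\<beta>\<in>UNIV. \<Sum>\<alpha>\<in>UNIV. c (\<alpha> \<cdot>\<^sub>F \<beta>) * (y \<alpha> * x \<beta>))"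
    by (rule sum.swap)
  also have "\<dots> = (\<Sum>\<alpha>\<in>UNIV. \<Sum>\<beta>\<in>UNIV. c (\<alpha> \<cdot>\<^sub>F \<beta>) * (x \<alpha> * y \<beta>))"
  proof (intro sum.cong refl)
    fix \<alpha> \<beta> :: 'n
    have "\<beta> \<cdot>\<^sub>F \<alpha> = \<alpha> \<cdot>\<^sub>F \<beta>" by simp
    then show "c (\<beta> \<cdot>\<^sub>F \<alpha>) * (y \<beta> * x \<alpha>) = c (\<alpha> \<cdot>\<^sub>F \<beta>) * (x \<alpha> * y \<beta>)"
      by (simp only: mult.commute)
  qed
  finally have swap: "(\<Sum>\<alpha>\<in>UNIV. \<Sum>\<beta>\<in>UNIV. c (\<alpha> \<cdot>\<^sub>F \<beta>) * (y \<alpha> * x \<beta>))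
      = (\<Sum>\<alpha>\<in>UNIV. \<Sum>\<beta>\<in>UNIV. c (\<alpha> \<cdot>\<^sub>F \<beta>) * (x \<alpha> * y \<beta>))" .
  have "(\<Sum>\<alpha>\<in>UNIV. \<Sum>\<beta>\<in>UNIV. c (\<alpha> \<cdot>\<^sub>F \<beta>) * ((x \<alpha> + y \<alpha>) * (x \<beta> + y \<beta>)))
    = (\<Sum>\<alpha>\<in>UNIV. \<Sum>\<beta>\<in>UNIV. c (\<alpha> \<cdot>\<^sub>F \<beta>) * (x \<alpha> * x \<beta>)) + (\<Sum>\<alpha>\<in>UNIV. \<Sum>\<beta>\<in>UNIV. c (\<alpha> \<cdot>\<^sub>F \<beta>) * (y \<alpha> * y \<beta>))
      + ((\<Sum>\<alpha>\<in>UNIV. \<Sum>\<beta>\<in>UNIV. c (\<alpha> \<cdot>\<^sub>F \<beta>) * (x \<alpha> * y \<beta>)) + (\<Sum>\<alpha>\<in>UNIV. \<Sum>\<beta>\<in>UNIV. c (\<alpha> \<cdot>\<^sub>F \<beta>) * (y \<alpha> * x \<beta>)))"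
    by (simp add: distrib_left distrib_right sum.distrib)
  then show ?thesis
    unfolding germ2_def swap by (simp add: distrib_left distrib_right sum.distrib)
qed

section \<open>Control functions and the halving argument\<close>

lemma controlD:
  assumes "control S T \<omega>" "S \<le> s" "s \<le> u" "u \<le> t" "t \<le> T"
  shows control_nonneg: "0 \<le> \<omega> s t"
    and control_left_le: "\<omega> s u \<le> \<omega> s t"
    and control_right_le: "\<omega> u t \<le> \<omega> s t"
    and control_superadd: "\<omega> s u + \<omega> u t \<le> \<omega> s t"
    and control_refl: "\<omega> s s = 0"
proof -
  have nonneg: "0 \<le> \<omega> x y" if "S \<le> x" "x \<le> y" "y \<le> T" for x y
    using assms(1) that by (auto simp: control_def simplex2_def)
  show sup: "\<omega> s u + \<omega> u t \<le> \<omega> s t" and "\<omega> s s = 0"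
    using assms by (auto simp: control_def)
  show "0 \<le> \<omega> s t" "\<omega> s u \<le> \<omega> s t" "\<omega> u t \<le> \<omega> s t"
    using sup nonneg[of s t] nonneg[of s u] nonneg[of u t] assms by auto
qed

lemma control_continuous_on:
  assumes "control S T \<omega>" "S \<le> s" "t \<le> T"
  shows "continuous_on {s..t} (\<omega> s)"
proof -
  have "continuous_on (simplex2 {S..T}) (\<lambda>(s, t). \<omega> s t)"
    using assms(1) by (simp add: control_def)
  then have "continuous_on {s..t} (\<lambda>u. case (s, u) of (s, t) \<Rightarrow> \<omega> s t)"
    by (rule continuous_on_compose2) (use assms in \<open>auto simp: simplex2_def intro!: continuous_intros\<close>)
  then show ?thesis by simp
qed

text \<open>The intermediate value theorem gives equality on the left piece; superadditivity leaves
  at most the other half for the right piece.\<close>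

lemma control_midpoint:
  assumes \<omega>: "control S T \<omega>" and st: "S \<le> s" "s \<le> t" "t \<le> T"
  obtains u where "s \<le> u" "u \<le> t" "\<omega> s u \<le> \<omega> s t / 2" "\<omega> u t \<le> \<omega> s t / 2"
proof -
  have "0 \<le> \<omega> s t" "\<omega> s s = 0" using controlD[OF \<omega> st(1) order_refl st(2,3)] by auto
  then obtain u where u: "s \<le> u" "u \<le> t" "\<omega> s u = \<omega> s t / 2"
    using IVT'[of "\<omega> s" s "\<omega> s t / 2" t] control_continuous_on[OF \<omega> st(1,3)] st(2) by auto
  moreover have "\<omega> u t \<le> \<omega> s t / 2"
    using control_superadd[OF \<omega> st(1) u(1,2) st(3)] u(3) by simp
  ultimately show ?thesis using that by simp
qed

text \<open>Each of the two pieces contributes at most N (\<omega>/2)^\<theta>; together this is the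
  factor 2 * 2^(-\<theta>) in front of N.\<close>

lemma sewing_step:
  fixes D :: "real \<Rightarrow> real \<Rightarrow> 'v::real_normed_vector"
  assumes \<omega>: "control S T \<omega>" and \<theta>: "0 \<le> \<theta>" and "0 \<le> N"
    and N: "\<And>s t. S \<le> s \<Longrightarrow> s \<le> t \<Longrightarrow> t \<le> R \<Longrightarrow> norm (D s t) \<le> N * \<omega> s t powr \<theta>"
    and \<Lambda>: "\<And>s u t. S \<le> s \<Longrightarrow> s \<le> u \<Longrightarrow> u \<le> t \<Longrightarrow> t \<le> R \<Longrightarrow>
      norm (D s t - D s u - D u t) \<le> \<Lambda> * \<omega> s t powr \<theta>"
    and st: "S \<le> s" "s \<le> t" "t \<le> R" "R \<le> T"
  shows "norm (D s t) \<le> (2 powr (1 - \<theta>) * N + \<Lambda>) * \<omega> s t powr \<theta>"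
proof -
  obtain u where u: "s \<le> u" "u \<le> t" "\<omega> s u \<le> \<omega> s t / 2" "\<omega> u t \<le> \<omega> s t / 2"
    using control_midpoint[OF \<omega> st(1,2)] st by (metis order_trans)
  have "0 \<le> \<omega> s t" "0 \<le> \<omega> s u" "0 \<le> \<omega> u t"
    using control_nonneg[OF \<omega> _ order_refl] u st by auto
  have half: "norm (D x y) \<le> N * (\<omega> s t / 2) powr \<theta>"
    if "S \<le> x" "x \<le> y" "y \<le> R" "0 \<le> \<omega> x y" "\<omega> x y \<le> \<omega> s t / 2" for x y
    using N[OF that(1-3)] powr_mono2[OF \<theta> that(4,5)] \<open>0 \<le> N\<close> by (meson mult_left_mono order_trans)
  have "norm (D s t) \<le> norm (D s t - D s u - D u t) + norm (D s u) + norm (D u t)"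
    using norm_triangle_ineq[of "D s t - D s u - D u t" "D s u + D u t"] norm_triangle_ineq[of "D s u" "D u t"]
    by simp
  also have "\<dots> \<le> \<Lambda> * \<omega> s t powr \<theta> + N * (\<omega> s t / 2) powr \<theta> + N * (\<omega> s t / 2) powr \<theta>"
    using u st \<open>0 \<le> \<omega> s u\<close> \<open>0 \<le> \<omega> u t\<close> by (intro add_mono \<Lambda> half) auto
  also have "\<dots> = (2 powr (1 - \<theta>) * N + \<Lambda>) * \<omega> s t powr \<theta>"
    using \<open>0 \<le> \<omega> s t\<close> by (simp add: powr_divide powr_diff algebra_simps)
  finally show ?thesis .
qed

text \<open>The bound \<open>N\<close> improves to \<open>(2\<^bsup>1-\<theta>\<^esup> + \<kappa>) N\<close> in each step, so it can be iterated down to \<open>0\<close>.\<close>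

lemma sewing_contraction:
  fixes D :: "real \<Rightarrow> real \<Rightarrow> 'v::real_normed_vector"
  assumes \<omega>: "control S T \<omega>" and "R \<le> T" and \<theta>: "0 \<le> \<theta>" and "0 \<le> N" "0 \<le> \<kappa>"
    and q: "2 powr (1 - \<theta>) + \<kappa> < 1"
    and N: "\<And>s t. S \<le> s \<Longrightarrow> s \<le> t \<Longrightarrow> t \<le> R \<Longrightarrow> norm (D s t) \<le> N * \<omega> s t powr \<theta>"
    and \<kappa>: "\<And>M s u t. 0 \<le> M \<Longrightarrow>
      (\<And>s t. S \<le> s \<Longrightarrow> s \<le> t \<Longrightarrow> t \<le> R \<Longrightarrow> norm (D s t) \<le> M * \<omega> s t powr \<theta>) \<Longrightarrow>
      S \<le> s \<Longrightarrow> s \<le> u \<Longrightarrow> u \<le> t \<Longrightarrow> t \<le> R \<Longrightarrow>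
      norm (D s t - D s u - D u t) \<le> \<kappa> * M * \<omega> s t powr \<theta>"
    and st: "S \<le> s" "s \<le> t" "t \<le> R"
  shows "D s t = 0"
proof -
  let ?q = "2 powr (1 - \<theta>) + \<kappa>"
  have "0 \<le> ?q" using \<open>0 \<le> \<kappa>\<close> by simp
  \<comment> \<open>The bound is proved for all subintervals at once, because the defect estimate
    takes a bound that is uniform over subintervals as its input.\<close>
  have bound: "norm (D s t) \<le> (?q ^ n * N) * \<omega> s t powr \<theta>" if "S \<le> s" "s \<le> t" "t \<le> R" for n s t
    using that
  proof (induction n arbitrary: s t)
    case 0
    then show ?case using N by simp
  next
    case (Suc n)
    have nonneg: "0 \<le> ?q ^ n * N" using \<open>0 \<le> ?q\<close> \<open>0 \<le> N\<close> by simp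
    have "norm (D s t) \<le> (2 powr (1 - \<theta>) * (?q ^ n * N) + \<kappa> * (?q ^ n * N)) * \<omega> s t powr \<theta>"
      by (rule sewing_step[OF \<omega> \<theta> nonneg Suc.IH \<kappa>[OF nonneg Suc.IH] Suc.prems \<open>R \<le> T\<close>])
    then show ?case by (simp add: algebra_simps)
  qed
  have "(\<lambda>n. (?q ^ n * N) * \<omega> s t powr \<theta>) \<longlonglongrightarrow> (0 * N) * \<omega> s t powr \<theta>"
    using \<open>0 \<le> ?q\<close> q by (intro tendsto_mult tendsto_const LIMSEQ_power_zero) simp
  then have "norm (D s t) \<le> 0"
    using bound[OF st] by (intro LIMSEQ_le_const) auto
  then show ?thesis by simp
qed

lemma control_small:
  assumes \<omega>: "control S T \<omega>" and "S < T" "0 < e"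
  obtains R where "S < R" "R \<le> T" "\<omega> S R < e"
proof -
  have "\<omega> S S = 0" using control_refl[OF \<omega>, of S S S] \<open>S < T\<close> by simp
  have "continuous_on {S..T} (\<omega> S)"
    using control_continuous_on[OF \<omega>, of S T] by simp
  then obtain d where "0 < d" and d: "\<And>t. t \<in> {S..T} \<Longrightarrow> dist t S < d \<Longrightarrow> dist (\<omega> S t) (\<omega> S S) < e"
    using \<open>S < T\<close> \<open>0 < e\<close> unfolding continuous_on_iff by (metis atLeastAtMost_iff less_imp_le order_refl)
  define R where "R = min T (S + d / 2)"
  have R: "S < R" "R \<le> T" "dist R S < d"
    using \<open>0 < d\<close> \<open>S < T\<close> by (auto simp: R_def dist_real_def)
  with d[of R] \<open>\<omega> S S = 0\<close> show ?thesis
    by (intro that[of R]) (auto simp: dist_real_def)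
qed

section \<open>The expansion of integral curves in the standard chart\<close>

definition flow_germ :: "('m \<Rightarrow> 'n::finite forest \<Rightarrow> real^'m::finite \<Rightarrow> real) \<Rightarrow>
    ('n forest \<Rightarrow> real \<Rightarrow> real \<Rightarrow> real) \<Rightarrow> real \<Rightarrow> real \<Rightarrow> real^'m \<Rightarrow> real^'m" where
  "flow_germ F X s t p = (\<chi> i. germ1 (\<lambda>\<tau>. F i \<tau> p) (\<lambda>\<alpha>. X (Vertex \<alpha>) s t)
      + germ2 (\<lambda>\<tau>. F i \<tau> p) (\<lambda>\<alpha>. X (Vertex \<alpha>) s t) (\<lambda>\<alpha> \<beta>. X (Ladder \<alpha> \<beta>) s t))"

text \<open>The product relation eliminates the components of X at pairs, and the symmetry factors
  turn into the half in \<open>germ2\<close>; so \<open>flow_germ\<close> is the sum in the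
  definition of an integral curve.\<close>

lemma sum_forest_eq_flow_germ:
  assumes "branched_rough_path S T p \<omega> X" "S \<le> s" "s \<le> t" "t \<le> T"
  shows "(\<Sum>\<tau>\<in>UNIV. 1 / sym_factor \<tau> * F i \<tau> q * X \<tau> s t) = flow_germ F X s t q $ i"
proof -
  have "X (\<alpha> \<cdot>\<^sub>F \<beta>) s t = X (Vertex \<alpha>) s t * X (Vertex \<beta>) s t" for \<alpha> \<beta>
    using assms unfolding branched_rough_path_def by blast
  then show ?thesis
    using sum_forest_sym_factor[of "\<lambda>\<tau>. F i \<tau> q * X \<tau> s t"]
    by (simp add: flow_germ_def germ1_def germ2_def mult.assoc)
qed

text \<open>The identity is a global chart, so the condition on compact subintervals can be used
  once, on the whole interval, and yields a single constant.\<close>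

lemma integral_curve_standard_chart:
  fixes Y :: "real \<Rightarrow> real^'m::finite"
  assumes "integral_curve S T p \<omega> X f Y" and X: "branched_rough_path S T p \<omega> X" and "S \<le> T"
  obtains C where "0 < C" "\<And>i s t. S \<le> s \<Longrightarrow> s \<le> t \<Longrightarrow> t \<le> T \<Longrightarrow>
    \<bar>(Y t - Y s - flow_germ (\<lambda>i \<tau> q. fiber_coords id (f q) i \<tau>) X s t (Y s)) $ i\<bar> \<le> C * \<omega> s t powr (3 / p)"
proof -
  obtain C where "C > 0" and C: "\<forall>i. \<forall>(s, t)\<in>simplex2 {S..T}.
      \<bar>id (Y t) $ i - id (Y s) $ i
        - (\<Sum>\<tau>\<in>UNIV. 1 / sym_factor \<tau> * fiber_coords id (f (Y s)) i \<tau> * X \<tau> s t)\<bar> \<le> C * \<omega> s t powr (3 / p)"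
    using assms(1)[unfolded integral_curve_def, THEN conjunct2, rule_format, of S T UNIV id] chart_id \<open>S \<le> T\<close>
    by auto
  show ?thesis
  proof (rule that[OF \<open>C > 0\<close>])
    fix i s t assume st: "S \<le> s" "s \<le> t" "t \<le> T"
    then have "(s, t) \<in> simplex2 {S..T}" by (simp add: simplex2_def)
    with C have "\<bar>id (Y t) $ i - id (Y s) $ i
        - (\<Sum>\<tau>\<in>UNIV. 1 / sym_factor \<tau> * fiber_coords id (f (Y s)) i \<tau> * X \<tau> s t)\<bar> \<le> C * \<omega> s t powr (3 / p)"
      by blast
    then show "\<bar>(Y t - Y s - flow_germ (\<lambda>i \<tau> q. fiber_coords id (f q) i \<tau>) X s t (Y s)) $ i\<bar> \<le> C * \<omega> s t powr (3 / p)"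
      using sum_forest_eq_flow_germ[OF X st, of "\<lambda>i \<tau> q. fiber_coords id (f q) i \<tau>" i "Y s"] by simp
  qed
qed

lemma flow_germ_chen:
  assumes X: "branched_rough_path S T p \<omega> X" and sut: "S \<le> s" "s \<le> u" "u \<le> t" "t \<le> T"
  shows "flow_germ F X s t q $ i = flow_germ F X s u q $ i + flow_germ F X u t q $ i
    + (\<Sum>\<alpha>\<in>UNIV. \<Sum>\<beta>\<in>UNIV. (F i (\<alpha> \<cdot>\<^sub>F \<beta>) q + F i (Ladder \<alpha> \<beta>) q) * (X (Vertex \<alpha>) s u * X (Vertex \<beta>) u t))"
proof -
  have "X (Vertex \<alpha>) s t = X (Vertex \<alpha>) s u + X (Vertex \<alpha>) u t"
    "X (Ladder \<alpha> \<beta>) s t = X (Ladder \<alpha> \<beta>) s u + X (Ladder \<alpha> \<beta>) u t + X (Vertex \<alpha>) s u * X (Vertex \<beta>) u t" for \<alpha> \<beta>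
    using X sut unfolding branched_rough_path_def by blast+
  then show ?thesis by (simp add: flow_germ_def germ1_add germ2_chen)
qed

lemma flow_germ_diff:
  "flow_germ F X s t p $ i - flow_germ F X s t q $ i =
    germ1 (\<lambda>\<tau>. F i \<tau> p - F i \<tau> q) (\<lambda>\<alpha>. X (Vertex \<alpha>) s t)
      + germ2 (\<lambda>\<tau>. F i \<tau> p - F i \<tau> q) (\<lambda>\<alpha>. X (Vertex \<alpha>) s t) (\<lambda>\<alpha> \<beta>. X (Ladder \<alpha> \<beta>) s t)"
  by (simp add: flow_germ_def germ1_diff[symmetric] germ2_diff[symmetric])

text \<open>For one curve the endpoints cancel, and by Chen's relation the defect of its remainder
  is the germ over [u,t] at Y(u), minus the one at Y(s), minus the cross term. This is the quantity
  compared in \<open>germ_defect_difference_bigo\<close>. The bound \<open>d\<close> there becomes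
  |D(s,u)|, since D(s,u) is the difference of the two remainders over [s,u].\<close>

lemma remainder_defect_bound:
  fixes F :: "'m::finite \<Rightarrow> 'n::finite forest \<Rightarrow> real^'m \<Rightarrow> real" and Y Y' :: "real \<Rightarrow> real^'m"
  assumes F: "\<And>i \<tau>. smooth_on UNIV (F i \<tau>)"
    and adm: "\<And>i \<alpha> \<beta> p. (\<Sum>j\<in>UNIV. partial j (F i (Vertex \<beta>)) p * F j (Vertex \<alpha>) p)
      = F i (\<alpha> \<cdot>\<^sub>F \<beta>) p + F i (Ladder \<alpha> \<beta>) p"
    and p: "1 \<le> p" and \<omega>: "control S T \<omega>" and X: "branched_rough_path S T p \<omega> X"
    and Y: "continuous_on {S..T} Y" "continuous_on {S..T} Y'"
    and C: "\<And>i s t. S \<le> s \<Longrightarrow> s \<le> t \<Longrightarrow> t \<le> T \<Longrightarrow>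
      \<bar>(Y t - Y s - flow_germ F X s t (Y s)) $ i\<bar> \<le> C * \<omega> s t powr (3 / p)"
    and C': "\<And>i s t. S \<le> s \<Longrightarrow> s \<le> t \<Longrightarrow> t \<le> T \<Longrightarrow>
      \<bar>(Y' t - Y' s - flow_germ F X s t (Y' s)) $ i\<bar> \<le> C' * \<omega> s t powr (3 / p)"
    and R: "R \<le> T" "\<omega> S R \<le> 1"
  defines "D \<equiv> \<lambda>s t. (Y t - Y s - flow_germ F X s t (Y s)) - (Y' t - Y' s - flow_germ F X s t (Y' s))"
  obtains K where "0 \<le> K" "\<And>s u t. S \<le> s \<Longrightarrow> s \<le> u \<Longrightarrow> u \<le> t \<Longrightarrow> t \<le> R \<Longrightarrow>
    norm (D s t - D s u - D u t)
      \<le> K * (norm (Y s - Y' s) * \<omega> s t powr (3 / p) + norm (D s u) * \<omega> s t powr (1 / p))"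
proof -
  define \<Delta> where "\<Delta> = {(s, u, t). S \<le> s \<and> s \<le> u \<and> u \<le> t \<and> t \<le> R}"
  define w where "w = (\<lambda>(s, u :: real, t). \<omega> s t powr (1 / p))"
  \<comment> \<open>The convex hull contains the segments along which the mean value arguments run,
    and it is still compact.\<close>
  define B where "B = convex hull (Y ` {S..T} \<union> Y' ` {S..T})"
  have B: "compact B" "convex B"
    unfolding B_def using Y by (auto intro!: compact_convex_hull compact_Un compact_continuous_image)
  have YB: "Y s \<in> B" "Y' s \<in> B" if "s \<in> {S..T}" for s
    unfolding B_def using that by (auto intro: hull_inc)
  have \<omega>01: "0 \<le> \<omega> s u" "\<omega> s u \<le> \<omega> s t" "0 \<le> \<omega> u t" "\<omega> u t \<le> \<omega> s t" "\<omega> s t \<le> 1"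
    if "(s, u, t) \<in> \<Delta>" for s u t
  proof -
    have *: "S \<le> s" "s \<le> u" "u \<le> t" "t \<le> R" using that by (auto simp: \<Delta>_def)
    have "\<omega> s t \<le> \<omega> S t" "\<omega> S t \<le> \<omega> S R"
      using control_right_le[OF \<omega>, of S s t] control_left_le[OF \<omega>, of S t R] * R(1) by auto
    with R(2) show "\<omega> s t \<le> 1" by simp
    show "0 \<le> \<omega> s u" "\<omega> s u \<le> \<omega> s t" "0 \<le> \<omega> u t" "\<omega> u t \<le> \<omega> s t"
      using controlD[OF \<omega>, of s u t] control_nonneg[OF \<omega>, of s u u] control_nonneg[OF \<omega>, of u u t] * R(1) by auto
  qed
  have w_pow: "w (s, u, t) * w (s, u, t) = \<omega> s t powr (2 / p)"
    "w (s, u, t) * w (s, u, t) * w (s, u, t) = \<omega> s t powr (3 / p)" for s u t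
    by (simp_all add: w_def powr_add[symmetric])
  obtain Cx where "Cx > 0" and Cx_all: "\<forall>\<alpha> \<beta>. \<forall>(s, t)\<in>simplex2 {S..T}.
        \<bar>X (Vertex \<alpha>) s t\<bar> \<le> Cx * \<omega> s t powr (1 / p) \<and>
        \<bar>X (\<alpha> \<cdot>\<^sub>F \<beta>) s t\<bar> \<le> Cx * \<omega> s t powr (2 / p) \<and>
        \<bar>X (Ladder \<alpha> \<beta>) s t\<bar> \<le> Cx * \<omega> s t powr (2 / p)"
    using X unfolding branched_rough_path_def by blast
  have Cx: "\<And>\<alpha> \<beta> s t. S \<le> s \<Longrightarrow> s \<le> t \<Longrightarrow> t \<le> T \<Longrightarrow>
      \<bar>X (Vertex \<alpha>) s t\<bar> \<le> Cx * \<omega> s t powr (1 / p) \<and> \<bar>X (Ladder \<alpha> \<beta>) s t\<bar> \<le> Cx * \<omega> s t powr (2 / p)"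
    using Cx_all by (fastforce simp: simplex2_def)
  have mono: "c * \<omega> s u powr e \<le> c * \<omega> s t powr e" "c * \<omega> u t powr e \<le> c * \<omega> s t powr e"
    if "(s, u, t) \<in> \<Delta>" "0 \<le> e" "0 \<le> c" for s u t c e
    using \<omega>01[OF that(1)] that(2,3) by (auto intro!: mult_left_mono powr_mono2)
  have X_le: "\<bar>X (Vertex \<alpha>) s u\<bar> \<le> Cx * \<omega> s t powr (1 / p)" "\<bar>X (Vertex \<alpha>) u t\<bar> \<le> Cx * \<omega> s t powr (1 / p)"
    "\<bar>X (Ladder \<alpha> \<beta>) s u\<bar> \<le> Cx * \<omega> s t powr (2 / p)" "\<bar>X (Ladder \<alpha> \<beta>) u t\<bar> \<le> Cx * \<omega> s t powr (2 / p)"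
    if \<Delta>: "(s, u, t) \<in> \<Delta>" for s u t \<alpha> \<beta>
  proof -
    have "S \<le> s" "s \<le> u" "u \<le> t" "t \<le> T" using \<Delta> R(1) by (auto simp: \<Delta>_def)
    moreover have e: "0 \<le> 1 / p" "0 \<le> 2 / p" "0 \<le> Cx" using p \<open>Cx > 0\<close> by auto
    ultimately show "\<bar>X (Vertex \<alpha>) s u\<bar> \<le> Cx * \<omega> s t powr (1 / p)" "\<bar>X (Vertex \<alpha>) u t\<bar> \<le> Cx * \<omega> s t powr (1 / p)"
    "\<bar>X (Ladder \<alpha> \<beta>) s u\<bar> \<le> Cx * \<omega> s t powr (2 / p)" "\<bar>X (Ladder \<alpha> \<beta>) u t\<bar> \<le> Cx * \<omega> s t powr (2 / p)"
      using Cx[of s u \<alpha> \<beta>] Cx[of u t \<alpha> \<beta>] mono[OF \<Delta> e(1,3)] mono[OF \<Delta> e(2,3)] by linarith+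
  qed
  let ?a = "\<lambda>(s, u :: real, t :: real). Y s" and ?b = "\<lambda>(s :: real, u, t :: real). Y u"
  let ?a' = "\<lambda>(s, u :: real, t :: real). Y' s" and ?b' = "\<lambda>(s :: real, u, t :: real). Y' u"
  let ?x = "\<lambda>(s, u, t :: real) \<alpha>. X (Vertex \<alpha>) s u" and ?y = "\<lambda>(s :: real, u, t) \<alpha>. X (Vertex \<alpha>) u t"
  let ?k = "\<lambda>(s, u, t :: real) \<alpha> \<beta>. X (Ladder \<alpha> \<beta>) s u" and ?l = "\<lambda>(s :: real, u, t) \<alpha> \<beta>. X (Ladder \<alpha> \<beta>) u t"
  let ?d = "\<lambda>(s, u, t :: real). norm (D s u)"
  have rem_bigo: "(\<lambda>\<xi>. (case \<xi> of (s, u, t) \<Rightarrow> (Z u - Z s - flow_germ F X s u (Z s)) $ i)) \<in> O[principal \<Delta>](\<lambda>\<xi>. w \<xi> * w \<xi>)"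
    if Z: "\<And>i s t. S \<le> s \<Longrightarrow> s \<le> t \<Longrightarrow> t \<le> T \<Longrightarrow>
      \<bar>(Z t - Z s - flow_germ F X s t (Z s)) $ i\<bar> \<le> c * \<omega> s t powr (3 / p)" for Z c i
  proof (rule bigo_principalI)
    fix \<xi> assume "\<xi> \<in> \<Delta>"
    then obtain s u t where \<xi>: "\<xi> = (s, u, t)" "(s, u, t) \<in> \<Delta>" by (cases \<xi>) auto
    have "\<bar>(Z u - Z s - flow_germ F X s u (Z s)) $ i\<bar> \<le> c * \<omega> s u powr (3 / p)"
      using \<xi>(2) R(1) by (intro Z) (auto simp: \<Delta>_def)
    also have "\<dots> \<le> \<bar>c\<bar> * \<omega> s t powr (3 / p)"
    proof -
      have "c * \<omega> s u powr (3 / p) \<le> \<bar>c\<bar> * \<omega> s u powr (3 / p)" by (intro mult_right_mono) auto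
      then show ?thesis using mono(1)[OF \<xi>(2), of "3 / p" "\<bar>c\<bar>"] p by simp
    qed
    \<comment> \<open>As \<open>\<omega> s t\<close> is at most 1, the exponent may drop to 2/p, the
      order in which the comparison takes each single remainder.\<close>
    also have "\<dots> \<le> \<bar>c\<bar> * \<omega> s t powr (2 / p)"
      using \<omega>01[OF \<xi>(2)] p by (intro mult_left_mono powr_mono') (auto simp: divide_right_mono)
    finally show "\<bar>case \<xi> of (s, u, t) \<Rightarrow> (Z u - Z s - flow_germ F X s u (Z s)) $ i\<bar> \<le> \<bar>c\<bar> * \<bar>w \<xi> * w \<xi>\<bar>"
      by (simp add: \<xi>(1) w_pow)
  qed
  have rem_C: "(\<lambda>\<xi>. (case \<xi> of (s, u, t) \<Rightarrow> (Y u - Y s - flow_germ F X s u (Y s)) $ i)) \<in> O[principal \<Delta>](\<lambda>\<xi>. w \<xi> * w \<xi>)" for i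
    by (rule rem_bigo) (rule C)
  have rem_C': "(\<lambda>\<xi>. (case \<xi> of (s, u, t) \<Rightarrow> (Y' u - Y' s - flow_germ F X s u (Y' s)) $ i)) \<in> O[principal \<Delta>](\<lambda>\<xi>. w \<xi> * w \<xi>)" for i
    by (rule rem_bigo) (rule C')
  have main: "(\<lambda>(s, u, t). (D s t - D s u - D u t) $ i)
    \<in> O[principal \<Delta>](\<lambda>\<xi>. norm (?a \<xi> - ?a' \<xi>) * (w \<xi> * w \<xi> * w \<xi>) + ?d \<xi> * w \<xi>)" for i
  proof -
    let ?E = "\<lambda>a b \<xi>. germ1 (\<lambda>\<tau>. F i \<tau> (b \<xi>) - F i \<tau> (a \<xi>)) (?y \<xi>)
        + germ2 (\<lambda>\<tau>. F i \<tau> (b \<xi>) - F i \<tau> (a \<xi>)) (?y \<xi>) (?l \<xi>)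
        - (\<Sum>\<alpha>\<in>UNIV. \<Sum>\<beta>\<in>UNIV. (F i (\<alpha> \<cdot>\<^sub>F \<beta>) (a \<xi>) + F i (Ladder \<alpha> \<beta>) (a \<xi>)) * (?x \<xi> \<alpha> * ?y \<xi> \<beta>))"
    have "(\<lambda>\<xi>. ?E ?a ?b \<xi> - ?E ?a' ?b' \<xi>)
      \<in> O[principal \<Delta>](\<lambda>\<xi>. norm (?a \<xi> - ?a' \<xi>) * (w \<xi> * w \<xi> * w \<xi>) + ?d \<xi> * w \<xi>)"
    proof (rule germ_defect_difference_bigo[where k = ?k, OF F adm B])
      show "?a \<xi> \<in> B" "?b \<xi> \<in> B" "?a' \<xi> \<in> B" "?b' \<xi> \<in> B" if "\<xi> \<in> \<Delta>" for \<xi>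
        using that R(1) YB by (auto simp: \<Delta>_def)
      show "0 \<le> w \<xi>" "w \<xi> \<le> 1" "0 \<le> ?d \<xi>" if "\<xi> \<in> \<Delta>" for \<xi>
      proof -
        obtain s u t where \<xi>: "\<xi> = (s, u, t)" by (cases \<xi>) auto
        with that \<omega>01[of s u t] have "0 \<le> \<omega> s t" "\<omega> s t \<le> 1" by auto
        then show "0 \<le> w \<xi>" "w \<xi> \<le> 1" "0 \<le> ?d \<xi>"
          using p by (auto simp: w_def \<xi> intro!: powr_le1)
      qed
      show "(\<lambda>\<xi>. ?x \<xi> \<alpha>) \<in> O[principal \<Delta>](w)" "(\<lambda>\<xi>. ?y \<xi> \<alpha>) \<in> O[principal \<Delta>](w)"
        "(\<lambda>\<xi>. ?k \<xi> \<alpha> \<beta>) \<in> O[principal \<Delta>](\<lambda>\<xi>. w \<xi> * w \<xi>)"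
        "(\<lambda>\<xi>. ?l \<xi> \<alpha> \<beta>) \<in> O[principal \<Delta>](\<lambda>\<xi>. w \<xi> * w \<xi>)" for \<alpha> \<beta>
      proof -
        have "\<bar>?x \<xi> \<alpha>\<bar> \<le> Cx * \<bar>w \<xi>\<bar> \<and> \<bar>?y \<xi> \<alpha>\<bar> \<le> Cx * \<bar>w \<xi>\<bar>
            \<and> \<bar>?k \<xi> \<alpha> \<beta>\<bar> \<le> Cx * \<bar>w \<xi> * w \<xi>\<bar> \<and> \<bar>?l \<xi> \<alpha> \<beta>\<bar> \<le> Cx * \<bar>w \<xi> * w \<xi>\<bar>"
          if "\<xi> \<in> \<Delta>" for \<xi>
        proof -
          obtain s u t where \<xi>: "\<xi> = (s, u, t)" by (cases \<xi>) auto
          show ?thesis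
            using X_le(1,2)[of s u t \<alpha>] X_le(3,4)[of s u t \<alpha> \<beta>] that unfolding \<xi> w_pow by (simp add: w_def)
        qed
        then show "(\<lambda>\<xi>. ?x \<xi> \<alpha>) \<in> O[principal \<Delta>](w)" "(\<lambda>\<xi>. ?y \<xi> \<alpha>) \<in> O[principal \<Delta>](w)"
          "(\<lambda>\<xi>. ?k \<xi> \<alpha> \<beta>) \<in> O[principal \<Delta>](\<lambda>\<xi>. w \<xi> * w \<xi>)"
          "(\<lambda>\<xi>. ?l \<xi> \<alpha> \<beta>) \<in> O[principal \<Delta>](\<lambda>\<xi>. w \<xi> * w \<xi>)"
          by (blast intro: bigo_principalI)+
      qed
      show "(\<lambda>\<xi>. ?b \<xi> $ i - ?a \<xi> $ i - germ1 (\<lambda>\<tau>. F i \<tau> (?a \<xi>)) (?x \<xi>) - germ2 (\<lambda>\<tau>. F i \<tau> (?a \<xi>)) (?x \<xi>) (?k \<xi>))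
        \<in> O[principal \<Delta>](\<lambda>\<xi>. w \<xi> * w \<xi>)" for i
        using rem_C[of i] by (simp add: flow_germ_def case_prod_unfold algebra_simps)
      show "(\<lambda>\<xi>. ?b' \<xi> $ i - ?a' \<xi> $ i - germ1 (\<lambda>\<tau>. F i \<tau> (?a' \<xi>)) (?x \<xi>) - germ2 (\<lambda>\<tau>. F i \<tau> (?a' \<xi>)) (?x \<xi>) (?k \<xi>))
        \<in> O[principal \<Delta>](\<lambda>\<xi>. w \<xi> * w \<xi>)" for i
        using rem_C'[of i] by (simp add: flow_germ_def case_prod_unfold algebra_simps)
      show "(\<lambda>\<xi>. (?b \<xi> $ i - ?a \<xi> $ i - germ1 (\<lambda>\<tau>. F i \<tau> (?a \<xi>)) (?x \<xi>) - germ2 (\<lambda>\<tau>. F i \<tau> (?a \<xi>)) (?x \<xi>) (?k \<xi>))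
        - (?b' \<xi> $ i - ?a' \<xi> $ i - germ1 (\<lambda>\<tau>. F i \<tau> (?a' \<xi>)) (?x \<xi>) - germ2 (\<lambda>\<tau>. F i \<tau> (?a' \<xi>)) (?x \<xi>) (?k \<xi>)))
        \<in> O[principal \<Delta>](?d)" for i
      proof (rule bigo_principalI)
        fix \<xi> assume "\<xi> \<in> \<Delta>"
        obtain s u t where \<xi>: "\<xi> = (s, u, t)" by (cases \<xi>) auto
        have "(?b \<xi> $ i - ?a \<xi> $ i - germ1 (\<lambda>\<tau>. F i \<tau> (?a \<xi>)) (?x \<xi>) - germ2 (\<lambda>\<tau>. F i \<tau> (?a \<xi>)) (?x \<xi>) (?k \<xi>))
          - (?b' \<xi> $ i - ?a' \<xi> $ i - germ1 (\<lambda>\<tau>. F i \<tau> (?a' \<xi>)) (?x \<xi>) - germ2 (\<lambda>\<tau>. F i \<tau> (?a' \<xi>)) (?x \<xi>) (?k \<xi>))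
          = D s u $ i"
          by (simp add: D_def flow_germ_def \<xi>)
        then show "\<bar>(?b \<xi> $ i - ?a \<xi> $ i - germ1 (\<lambda>\<tau>. F i \<tau> (?a \<xi>)) (?x \<xi>) - germ2 (\<lambda>\<tau>. F i \<tau> (?a \<xi>)) (?x \<xi>) (?k \<xi>))
          - (?b' \<xi> $ i - ?a' \<xi> $ i - germ1 (\<lambda>\<tau>. F i \<tau> (?a' \<xi>)) (?x \<xi>) - germ2 (\<lambda>\<tau>. F i \<tau> (?a' \<xi>)) (?x \<xi>) (?k \<xi>))\<bar>
          \<le> 1 * \<bar>?d \<xi>\<bar>"
          using component_le_norm_cart[of "D s u" i] by (simp add: \<xi>)
      qed
    qed
    moreover have "?E ?a ?b \<xi> - ?E ?a' ?b' \<xi> = (case \<xi> of (s, u, t) \<Rightarrow> (D s t - D s u - D u t) $ i)"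
      if "\<xi> \<in> \<Delta>" for \<xi>
    proof -
      obtain s u t where \<xi>: "\<xi> = (s, u, t)" by (cases \<xi>) auto
      with that R(1) have "S \<le> s" "s \<le> u" "u \<le> t" "t \<le> T" by (auto simp: \<Delta>_def)
      then show ?thesis
        using flow_germ_chen[OF X, of s u t F "Y s" i] flow_germ_chen[OF X, of s u t F "Y' s" i]
          flow_germ_diff[of F X u t "Y u" i "Y s"] flow_germ_diff[of F X u t "Y' u" i "Y' s"]
        by (simp add: \<xi> D_def)
    qed
    ultimately show ?thesis
      by (subst (asm) landau_o.big.in_cong[where g = "\<lambda>(s, u, t). (D s t - D s u - D u t) $ i"])
        (auto simp: eventually_principal)
  qed
  have "(\<lambda>\<xi>. norm (case \<xi> of (s, u, t) \<Rightarrow> D s t - D s u - D u t))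
    \<in> O[principal \<Delta>](\<lambda>\<xi>. norm (?a \<xi> - ?a' \<xi>) * (w \<xi> * w \<xi> * w \<xi>) + ?d \<xi> * w \<xi>)"
    by (rule norm_bigo) (use main in \<open>simp add: case_prod_unfold\<close>)
  then obtain K where "K > 0" and ev: "\<forall>\<^sub>F \<xi> in principal \<Delta>. norm (norm (case \<xi> of (s, u, t) \<Rightarrow> D s t - D s u - D u t))
        \<le> K * norm (norm (?a \<xi> - ?a' \<xi>) * (w \<xi> * w \<xi> * w \<xi>) + ?d \<xi> * w \<xi>)"
    by (rule landau_o.bigE)
  have K: "norm (norm (case \<xi> of (s, u, t) \<Rightarrow> D s t - D s u - D u t))
        \<le> K * norm (norm (?a \<xi> - ?a' \<xi>) * (w \<xi> * w \<xi> * w \<xi>) + ?d \<xi> * w \<xi>)" if "\<xi> \<in> \<Delta>" for \<xi>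
    by (rule bspec[OF ev[unfolded eventually_principal] that])
  show ?thesis
  proof (rule that[of K])
    fix s u t assume "S \<le> s" "s \<le> u" "u \<le> t" "t \<le> R"
    then have "(s, u, t) \<in> \<Delta>" by (simp add: \<Delta>_def)
    from K[OF this] w_pow(2)[of s u t]
    show "norm (D s t - D s u - D u t)
      \<le> K * (norm (Y s - Y' s) * \<omega> s t powr (3 / p) + norm (D s u) * \<omega> s t powr (1 / p))"
      by (simp only: prod.case abs_norm_cancel real_norm_def) (simp add: w_def)
  qed (use \<open>K > 0\<close> in simp)
qed

section \<open>Uniqueness of integral curves on a short interval\<close>

theorem theorem4p20:
  fixes S T p :: real
    and \<omega> :: "real \<Rightarrow> real \<Rightarrow> real"
    and X :: "'n::finite forest \<Rightarrow> real \<Rightarrow> real \<Rightarrow> real"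
    and f :: "real^'m::finite \<Rightarrow> ('m, 'n) velocity"
    and Y Y' :: "real \<Rightarrow> real^'m"
  assumes "S < T"
    and "1 \<le> p" and "p < 3"
    and "control S T \<omega>"
    and "branched_rough_path S T p \<omega> X"
    and "rough_velocity_field f"
    and "compact (field_support f)"
    and "admissible f"
    and "integral_curve S T p \<omega> X f Y"
    and "integral_curve S T p \<omega> X f Y'"
    and "Y S = Y' S"
  shows "\<exists>\<epsilon>>0. S + \<epsilon> \<le> T \<and> (\<forall>t\<in>{S..S + \<epsilon>}. Y t = Y' t)"
proof -
  note \<omega> = \<open>control S T \<omega>\<close> and X = \<open>branched_rough_path S T p \<omega> X\<close>
  define F where "F = (\<lambda>i \<tau> q. fiber_coords id (f q) i \<tau>)"
  have F: "smooth_on UNIV (F i \<tau>)" for i \<tau>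
    using assms(6) chart_id unfolding rough_velocity_field_def F_def by blast
  have adm: "(\<Sum>j\<in>UNIV. partial j (F i (Vertex \<beta>)) q * F j (Vertex \<alpha>) q)
      = F i (\<alpha> \<cdot>\<^sub>F \<beta>) q + F i (Ladder \<alpha> \<beta>) q" for i \<alpha> \<beta> q
    unfolding F_def by (rule admissible_standard_coords[OF assms(6,8)])
  have cont: "continuous_on {S..T} Y" "continuous_on {S..T} Y'"
    using assms(9,10) by (auto simp: integral_curve_def)
  define G where "G = flow_germ F X"
  obtain C where C: "0 < C" "\<And>i s t. S \<le> s \<Longrightarrow> s \<le> t \<Longrightarrow> t \<le> T \<Longrightarrow>
      \<bar>(Y t - Y s - G s t (Y s)) $ i\<bar> \<le> C * \<omega> s t powr (3 / p)"
    using integral_curve_standard_chart[OF assms(9) X] \<open>S < T\<close> unfolding F_def G_def by (metis less_imp_le)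
  obtain C' where C': "0 < C'" "\<And>i s t. S \<le> s \<Longrightarrow> s \<le> t \<Longrightarrow> t \<le> T \<Longrightarrow>
      \<bar>(Y' t - Y' s - G s t (Y' s)) $ i\<bar> \<le> C' * \<omega> s t powr (3 / p)"
    using integral_curve_standard_chart[OF assms(10) X] \<open>S < T\<close> unfolding F_def G_def by (metis less_imp_le)
  define D where "D = (\<lambda>s t. (Y t - Y s - G s t (Y s)) - (Y' t - Y' s - G s t (Y' s)))"
  define \<theta> where "\<theta> = 3 / p"
  have \<theta>: "0 \<le> \<theta>" "1 < \<theta>" using assms(2,3) by (auto simp: \<theta>_def)
  \<comment> \<open>A preliminary endpoint that only normalises \<omega> to be at most 1, as needed
    to obtain K. The final R depends on K and is chosen afterwards.\<close>
  obtain R1 where R1: "S < R1" "R1 \<le> T" "\<omega> S R1 < 1"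
    using control_small[OF \<omega> \<open>S < T\<close>, of 1] by auto
  obtain K where "0 \<le> K" and K: "\<And>s u t. S \<le> s \<Longrightarrow> s \<le> u \<Longrightarrow> u \<le> t \<Longrightarrow> t \<le> R1 \<Longrightarrow>
      norm (D s t - D s u - D u t)
        \<le> K * (norm (Y s - Y' s) * \<omega> s t powr \<theta> + norm (D s u) * \<omega> s t powr (1 / p))"
  proof (rule remainder_defect_bound[OF F adm \<open>1 \<le> p\<close> \<omega> X cont _ _ \<open>R1 \<le> T\<close>])
    show "\<bar>(Y t - Y s - flow_germ F X s t (Y s)) $ i\<bar> \<le> C * \<omega> s t powr (3 / p)"
      "\<bar>(Y' t - Y' s - flow_germ F X s t (Y' s)) $ i\<bar> \<le> C' * \<omega> s t powr (3 / p)"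
      if "S \<le> s" "s \<le> t" "t \<le> T" for i s t
      using C(2)[OF that] C'(2)[OF that] unfolding G_def by auto
    show "\<omega> S R1 \<le> 1" using R1(3) by simp
  qed (use that in \<open>auto simp: D_def G_def \<theta>_def\<close>)
  \<comment> \<open>The gap that halving leaves below 1, shared out so that 2 K \<eta> still fits
    into it; the summand 1 keeps the divisor positive when K = 0.\<close>
  define \<eta> where "\<eta> = (1 - 2 powr (1 - \<theta>)) / (2 * K + 1)"
  have "2 powr (1 - \<theta>) < 2 powr 0" using \<theta> by (intro powr_less_mono) auto
  then have "0 < \<eta>" using \<open>0 \<le> K\<close> by (simp add: \<eta>_def)
  then have "0 < \<eta> powr p" by simp
  \<comment> \<open>The bound \<omega>(S,R) < 1 later allows the exponent \<theta> to be lowered to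
    1/p, and R \<le> R1 keeps K valid.\<close>
  obtain R where R: "S < R" "R \<le> T" "\<omega> S R < min (\<eta> powr p) 1" and "R \<le> R1"
  proof -
    obtain R where R: "S < R" "R \<le> T" "\<omega> S R < min (\<eta> powr p) 1"
      using control_small[OF \<omega> \<open>S < T\<close>, of "min (\<eta> powr p) 1"] \<open>0 < \<eta> powr p\<close> by auto
    have "\<omega> S (min R R1) \<le> \<omega> S R"
      using control_left_le[OF \<omega>, of S "min R R1" R] R R1 by auto
    then show ?thesis using R R1 by (intro that[of "min R R1"]) auto
  qed
  let ?W = "\<omega> S R powr (1 / p)"
  have "0 \<le> \<omega> S R" using control_nonneg[OF \<omega>, of S R R] R by simp
  have "?W < (\<eta> powr p) powr (1 / p)"
    using R(3) \<open>0 \<le> \<omega> S R\<close> assms(2) by (intro powr_less_mono2) auto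
  also have "\<dots> = \<eta>" using assms(2) \<open>0 < \<eta>\<close> by (simp add: powr_powr)
  finally have "(2 * K + 1) * ?W < (2 * K + 1) * \<eta>" using \<open>0 \<le> K\<close> by simp
  also have "\<dots> = 1 - 2 powr (1 - \<theta>)" using \<open>0 \<le> K\<close> by (simp add: \<eta>_def)
  finally have q: "2 powr (1 - \<theta>) + 2 * K * ?W < 1"
    by (simp add: distrib_right) (smt (verit) powr_ge_zero)
  have Z: "Y s - Y' s = D S s" for s
    using \<open>Y S = Y' S\<close> by (simp add: D_def)
  \<comment> \<open>The starting constant of the iteration: the triangle inequality for the two
    remainders in each component, then the sum over components.\<close>
  have D_le: "norm (D s t) \<le> (of_nat CARD('m) * (C + C')) * \<omega> s t powr \<theta>" if "S \<le> s" "s \<le> t" "t \<le> R" for s t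
  proof -
    have "\<bar>D s t $ i\<bar> \<le> (C + C') * \<omega> s t powr \<theta>" for i
      using C(2)[of s t i] C'(2)[of s t i] that R(2) by (simp add: D_def \<theta>_def distrib_right)
    then have "(\<Sum>i\<in>UNIV. \<bar>D s t $ i\<bar>) \<le> of_nat CARD('m) * ((C + C') * \<omega> s t powr \<theta>)"
      by (intro sum_bounded_above) simp
    then show ?thesis using norm_le_l1_cart[of "D s t"] by (simp add: mult.assoc)
  qed
  have "D s t = 0" if "S \<le> s" "s \<le> t" "t \<le> R" for s t
  proof (rule sewing_contraction[OF \<omega> R(2) \<theta>(1) _ _ q D_le _ that])
    show "0 \<le> of_nat CARD('m) * (C + C')" "0 \<le> 2 * K * ?W"
      using C(1) C'(1) \<open>0 \<le> K\<close> by simp_all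
    fix M s u t
    assume "0 \<le> M" and M: "\<And>s t. S \<le> s \<Longrightarrow> s \<le> t \<Longrightarrow> t \<le> R \<Longrightarrow> norm (D s t) \<le> M * \<omega> s t powr \<theta>"
      and sut: "S \<le> s" "s \<le> u" "u \<le> t" "t \<le> R"
    have le: "\<omega> S s \<le> \<omega> S R" "\<omega> s u \<le> \<omega> s t" "\<omega> s t \<le> \<omega> S R" "0 \<le> \<omega> S s" "0 \<le> \<omega> s u" "0 \<le> \<omega> s t"
    proof -
      show "\<omega> S s \<le> \<omega> S R" using control_left_le[OF \<omega>, of S s R] sut R by simp
      show "\<omega> s u \<le> \<omega> s t" using control_left_le[OF \<omega>, of s u t] sut R by simp
      have "\<omega> s t \<le> \<omega> S t" using control_right_le[OF \<omega>, of S s t] sut R by simp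
      also have "\<dots> \<le> \<omega> S R" using control_left_le[OF \<omega>, of S t R] sut R by simp
      finally show "\<omega> s t \<le> \<omega> S R" .
      show "0 \<le> \<omega> S s" "0 \<le> \<omega> s u" "0 \<le> \<omega> s t"
        using control_nonneg[OF \<omega> _ order_refl] sut R by auto
    qed
    \<comment> \<open>The current bound on D is used on [S,s]; lowering its exponent to 1/p leaves
      the small factor \<open>?W\<close>.\<close>
    have "norm (Y s - Y' s) \<le> M * \<omega> S s powr \<theta>"
      unfolding Z using M sut by simp
    also have "\<dots> \<le> M * ?W"
    proof -
      have "\<omega> S s powr \<theta> \<le> \<omega> S R powr \<theta>" using le \<theta> by (intro powr_mono2) auto
      also have "\<dots> \<le> ?W" using \<open>0 \<le> \<omega> S R\<close> R(3) assms(2)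
        by (intro powr_mono') (auto simp: \<theta>_def divide_right_mono)
      finally show ?thesis using \<open>0 \<le> M\<close> by (rule mult_left_mono)
    qed
    finally have 1: "norm (Y s - Y' s) * \<omega> s t powr \<theta> \<le> M * ?W * \<omega> s t powr \<theta>"
      by (rule mult_right_mono) simp
    have "norm (D s u) \<le> M * \<omega> s u powr \<theta>" using M sut by simp
    also have "\<dots> \<le> M * \<omega> s t powr \<theta>" using le \<theta> \<open>0 \<le> M\<close> by (intro mult_left_mono powr_mono2) auto
    finally have "norm (D s u) * \<omega> s t powr (1 / p) \<le> (M * \<omega> s t powr \<theta>) * ?W"
      using le assms(2) \<open>0 \<le> M\<close> by (intro mult_mono powr_mono2) auto
    \<comment> \<open>Both terms are at most M W \<omega>(s,t)^\<theta>, with W standing for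
      \<open>?W\<close>; this is the origin of the 2 in the contraction factor and in
      \<open>\<eta>\<close>.\<close>
    with 1 have "norm (Y s - Y' s) * \<omega> s t powr \<theta> + norm (D s u) * \<omega> s t powr (1 / p)
        \<le> 2 * ?W * M * \<omega> s t powr \<theta>" by (simp add: mult_ac)
    then have "K * (norm (Y s - Y' s) * \<omega> s t powr \<theta> + norm (D s u) * \<omega> s t powr (1 / p))
        \<le> K * (2 * ?W * M * \<omega> s t powr \<theta>)" using \<open>0 \<le> K\<close> by (rule mult_left_mono)
    with K[OF sut(1-3)] sut(4) \<open>R \<le> R1\<close>
    show "norm (D s t - D s u - D u t) \<le> 2 * K * ?W * M * \<omega> s t powr \<theta>" by (simp add: mult_ac)
  qed
  then have "Y t = Y' t" if "t \<in> {S..R}" for t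
    using Z[of t] that by simp
  then show ?thesis
    using R by (intro exI[of _ "R - S"]) simp
qed

end
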